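(* Fix $L_x,L_{xy},L_y,D_x,D_y,\epsilon>0$ and query costs $c_x,c_y$. Consider the class $\mathcal P_{\mathrm{SP}}$ and the algorithm DM-SP implemented with the local solver ARM, as described in the context, with $$\alpha_x=\frac{L_{xy}D_y}{D_x},\qquad\alpha_y=\frac{L_{xy}D_x}{D_y},\qquad\lambda_t\equiv\lambda=2.$$ Then the oracle complexity of DM-SP over $\mathcal P_{\mathrm{SP}}$ satisfies $$N^{\text{DM-SP}}_{\mathcal P_{\mathrm{SP}}}\le(c_x+c_y)\frac{2L_{xy}D_xD_y}{\epsilon}+102\Big(\frac{L_{xy}D_xD_y}{\epsilon}\Big)^{1/2}\left(c_x\Big(\frac{L_xD_x^2}{\epsilon}\Big)^{1/2}+c_y\Big(\frac{L_yD_y^2}{\epsilon}\Big)^{1/2}\right).$$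
   Context: Spaces. $\mathcal E_x=\mathbb R^{n_x}$ carries the norm $\|x\|_x=\langle P_xx,x\rangle^{1/2}$, where $P_x:\mathcal E_x\to\mathcal E_x^*$ is self-adjoint positive definite; $\|\cdot\|_{x^*}$ is the dual norm. Similarly $\mathcal E_y=\mathbb R^{n_y}$ with $P_y$, $\|\cdot\|_y$, $\|\cdot\|_{y^*}$. For $\alpha_x,\alpha_y>0$ the joint space $\mathcal E=\mathcal E_x\times\mathcal E_y$ has norm $\|z\|_{\mathcal E}^2=\alpha_x\|x\|_x^2+\alpha_y\|y\|_y^2$ for $z=(x,y)$, with dual norm $\|(g_x,g_y)\|_{\mathcal E^*}^2=\alpha_x^{-1}\|g_x\|_{x^*}^2+\alpha_y^{-1}\|g_y\|_{y^*}^2$. Problem class $\mathcal P_{\mathrm{SP}}$. An instance is $(f,\psi_x,\psi_y,z^0)$ with $\psi_x:\mathcal E_x\to\mathbb R\cup\{+\infty\}$, $\psi_y:\mathcal E_y\to\mathbb R\cup\{+\infty\}$, $Q=\operatorname{dom}\psi_x\times\operatorname{dom}\psi_y$, $f$ real-valued on an open set containing $Q$, $z^0=(x^0,y^0)\in Q$; the problem is $\min_{x\in\operatorname{dom}\psi_x}\max_{y\in\operatorname{dom}\psi_y}F(x,y)$, $F(x,y)=f(x,y)+\psi_x(x)-\psi_y(y)$. The class consists of all instances such that: (A1) $f(\cdot,y)$ is convex for each fixed $y\in\operatorname{dom}\psi_y$, $f(x,\cdot)$ is concave for each fixed $x\in\operatorname{dom}\psi_x$, and $\psi_x,\psi_y$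 are proper, closed and convex; (A2) there is a saddle point $(x^*,y^* )\in Q$ of $F$ with $\|x^0-x^*\|_x\le D_x$ and $\|y^0-y^*\|_y\le D_y$; (A3) $f$ is continuously differentiable over $Q$ and for all $x,x'\in\operatorname{dom}\psi_x$, $y,y'\in\operatorname{dom}\psi_y$: $\|\nabla_xf(x',y')-\nabla_xf(x,y)\|_{x^*}\le L_x\|x'-x\|_x+L_{xy}\|y'-y\|_y$ and $\|\nabla_yf(x',y')-\nabla_yf(x,y)\|_{y^*}\le L_{xy}\|x'-x\|_x+L_y\|y'-y\|_y$. Accuracy. $\mathcal B=\{(x,y):\|x^0-x\|_x\le D_x,\ \|y^0-y\|_y\le D_y\}$ and $\Delta(\bar x,\bar y)=\max_{(x,y)\in\mathcal B\cap Q}[F(\bar x,y)-F(x,\bar y)]$. A point $\bar z\in Q$ is an $\epsilon$-saddle point if $\Delta(\bar z)\le\epsilon$. Local solver ARM (Accumulative Regularization Method of Lan et al., a cited algorithm used through its guarantee). Let $f_w$ be continuously differentiable on an open set containing $\operatorname{dom}\psi_w$, $\psi_w$ proper closed convex, $\nabla f_w$ monotone and $L$-Lipschitz over $\operatorname{dom}\psi_w$, and suppose the set of $\tilde w$ with $0\in\nabla f_w(\tilde w)+\partial\psi_w(\tilde w)$ is non-empty. For $v_w\in\operatorname{dom}\psi_w$ and $\xi>0$, $\mathrm{ARM}(\nabla f_w,\psi_w,v_w,\xi\mid L)$ uses at most $34\sqrt{3L/(2\xi)}$ queries to $\nabla f_w$ and returns $w^+\in\operatorname{dom}\psi_w$ and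 $\psi_w'(w^+)\in\partial\psi_w(w^+)$ with $\|\nabla f_w(w^+)+\psi_w'(w^+)\|_{w^*}\le\xi\|v_w-\tilde w\|_w$ for some such $\tilde w$. Algorithm DM-SP with ARM, parameters $\alpha_x,\alpha_y>0$ and constant $\lambda>0$. Put $v^0=z^0$. Iteration $t=0,1,\dots$, given $v^t=(v^t_x,v^t_y)$: (1) With $\hat\psi_x=\psi_x+\frac{\alpha_x\lambda}2\|\cdot-v^t_x\|_x^2$, Agent $x$ computes $(x^{t+1},\hat\psi_x'(x^{t+1}))=\mathrm{ARM}(\nabla_xf(\cdot,v^t_y),\hat\psi_x,v^t_x,\frac{\alpha_x\lambda}3\mid L_x)$ and sets $\psi_x'(x^{t+1})=\hat\psi_x'(x^{t+1})-\alpha_x\lambda P_x(x^{t+1}-v^t_x)$. Symmetrically, with $\hat\psi_y=\psi_y+\frac{\alpha_y\lambda}2\|\cdot-v^t_y\|_y^2$, Agent $y$ computes $(y^{t+1},\hat\psi_y'(y^{t+1}))=\mathrm{ARM}(-\nabla_yf(v^t_x,\cdot),\hat\psi_y,v^t_y,\frac{\alpha_y\lambda}3\mid L_y)$ and sets $\psi_y'(y^{t+1})=\hat\psi_y'(y^{t+1})-\alpha_y\lambda P_y(y^{t+1}-v^t_y)$. (2) The agents exchange to form $z^{t+1}=(x^{t+1},y^{t+1})$ (first communication round of the iteration). (3) Each agent queries its partial gradient at $z^{t+1}$, and they exchange (second round) to form $V_\psi(z^{t+1})=(\nabla_xf(z^{t+1})+\psi_x'(x^{t+1}),-\nabla_yf(z^{t+1})+\psi_y'(y^{t+1}))$.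 (4) $a_{t+1}=2\langle V_\psi(z^{t+1}),v^t-z^{t+1}\rangle/\|V_\psi(z^{t+1})\|_{\mathcal E^*}^2$, candidate solution $\bar z^{t+1}=(\sum_{i=1}^{t+1}a_i)^{-1}\sum_{i=1}^{t+1}a_iz^i$. (5) $v^{t+1}=\arg\min_{v\in Q}[a_{t+1}\langle V_\psi(z^{t+1}),v\rangle+\frac12\|v-v^t\|_{\mathcal E}^2]$. Oracle complexity. $c_x$ and $c_y$ are fixed constants, the costs of a single query of Agent $x$ to $\nabla_xf$ and of Agent $y$ to $\nabla_yf$. For an instance $P$, $T_P$ is the smallest number of communication rounds after which the candidate solution is an $\epsilon$-saddle point, $N_{x,P}$ and $N_{y,P}$ are the total numbers of queries to $\nabla_xf$ by Agent $x$ and to $\nabla_yf$ by Agent $y$ made in these first $T_P$ rounds, and $N_{\mathcal P_{\mathrm{SP}}}=\sup_{P\in\mathcal P_{\mathrm{SP}}}(c_xN_{x,P}+c_yN_{y,P})$.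
   Formalization: With K = 2L_xy D_x D_y/ε, the bound is proved multiplied by ⌈K⌉/K (iteration count rounded up), and as displayed when K is an integer; the displayed bound fails for some other ε. Instances where a minimizer needed in step (5) does not exist have no run and are not counted. *)

theory Defs
  imports "HOL-Analysis.Analysis"
begin

section \<open>Norms\<close>

text \<open>The dual of a Euclidean space is identified with the space itself through the standard
  inner product, so \<open>\<langle>g, x\<rangle>\<close> is \<open>g \<bullet> x\<close>.\<close>

definition self_adjoint_pos_def :: "('a::euclidean_space \<Rightarrow> 'a) \<Rightarrow> bool" where
  "self_adjoint_pos_def P \<longleftrightarrow>
     linear P \<and> (\<forall>x y. P x \<bullet> y = x \<bullet> P y) \<and> (\<forall>x. x \<noteq> 0 \<longrightarrow> 0 < P x \<bullet> x)"

definition pnorm :: "('a::euclidean_space \<Rightarrow> 'a) \<Rightarrow> 'a \<Rightarrow> real" where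
  "pnorm P x = sqrt (P x \<bullet> x)"

definition dual_pnorm :: "('a::euclidean_space \<Rightarrow> 'a) \<Rightarrow> 'a \<Rightarrow> real" where
  "dual_pnorm P g = (SUP x\<in>{x. pnorm P x \<le> 1}. g \<bullet> x)"

section \<open>Extended-valued convex functions\<close>

definition edom :: "('a \<Rightarrow> ereal) \<Rightarrow> 'a set" where
  "edom \<psi> = {x. \<psi> x < \<infinity>}"

definition eepigraph :: "('a \<Rightarrow> ereal) \<Rightarrow> ('a \<times> real) set" where
  "eepigraph \<psi> = {(x, r). \<psi> x \<le> ereal r}"

definition proper_closed_convex :: "('a::euclidean_space \<Rightarrow> ereal) \<Rightarrow> bool" where
  "proper_closed_convex \<psi> \<longleftrightarrow>
     (\<forall>x. \<psi> x \<noteq> -\<infinity>) \<and> edom \<psi> \<noteq> {} \<and> closed (eepigraph \<psi>) \<and> convex (eepigraph \<psi>)"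

definition subdiff :: "('a::euclidean_space \<Rightarrow> ereal) \<Rightarrow> 'a \<Rightarrow> 'a set" where
  "subdiff \<psi> x = {g. x \<in> edom \<psi> \<and> (\<forall>y. \<psi> x + ereal (g \<bullet> (y - x)) \<le> \<psi> y)}"

section \<open>Gradients\<close>

definition grad :: "('a::euclidean_space \<Rightarrow> real) \<Rightarrow> 'a \<Rightarrow> 'a" where
  "grad f z = (THE g. GDERIV f z :> g)"

definition C1_on :: "'a::euclidean_space set \<Rightarrow> ('a \<Rightarrow> real) \<Rightarrow> bool" where
  "C1_on U f \<longleftrightarrow> (\<forall>z\<in>U. GDERIV f z :> grad f z) \<and> continuous_on U (grad f)"

definition grad_x :: "('a::euclidean_space \<times> 'b::euclidean_space \<Rightarrow> real) \<Rightarrow> 'a \<times> 'b \<Rightarrow> 'a" where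
  "grad_x f z = grad (\<lambda>x. f (x, snd z)) (fst z)"

definition grad_y :: "('a::euclidean_space \<times> 'b::euclidean_space \<Rightarrow> real) \<Rightarrow> 'a \<times> 'b \<Rightarrow> 'b" where
  "grad_y f z = grad (\<lambda>y. f (fst z, y)) (snd z)"

section \<open>The local solver\<close>

text \<open>A solver is called as \<open>S G \<psi> v \<xi> L\<close>, where \<open>G\<close> is the gradient oracle, and returns the point
  \<open>w\<^sup>+\<close>, a subgradient of \<open>\<psi>\<close> at \<open>w\<^sup>+\<close> and the number of queries made to \<open>G\<close>.\<close>

type_synonym 'a local_solver =
  "('a \<Rightarrow> 'a) \<Rightarrow> ('a \<Rightarrow> ereal) \<Rightarrow> 'a \<Rightarrow> real \<Rightarrow> real \<Rightarrow> 'a \<times> 'a \<times> nat"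

definition stationary_pts :: "('a::euclidean_space \<Rightarrow> 'a) \<Rightarrow> ('a \<Rightarrow> ereal) \<Rightarrow> 'a set" where
  "stationary_pts G \<psi> = {w. \<exists>g\<in>subdiff \<psi> w. G w + g = 0}"

text \<open>Nothing but this guarantee is known of the solver. The values of \<open>G\<close> outside the open set
  \<open>U\<close> are arbitrary, because the objective is not assumed to be defined there.\<close>

definition ARM_guarantee :: "('a::euclidean_space \<Rightarrow> 'a) \<Rightarrow> 'a local_solver \<Rightarrow> bool" where
  "ARM_guarantee P S \<longleftrightarrow>
     (\<forall>fw G U \<psi> v \<xi> L.
        open U \<and> edom \<psi> \<subseteq> U \<and> C1_on U fw \<and> (\<forall>w\<in>U. G w = grad fw w) \<and>
        proper_closed_convex \<psi> \<and>
        (\<forall>w\<in>edom \<psi>. \<forall>w'\<in>edom \<psi>. 0 \<le> (G w' - G w) \<bullet> (w' - w)) \<and>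
        (\<forall>w\<in>edom \<psi>. \<forall>w'\<in>edom \<psi>. dual_pnorm P (G w' - G w) \<le> L * pnorm P (w' - w)) \<and>
        stationary_pts G \<psi> \<noteq> {} \<and>
        v \<in> edom \<psi> \<and> 0 < \<xi> \<and> 0 < L
        \<longrightarrow> (case S G \<psi> v \<xi> L of (w, g, n) \<Rightarrow>
               real n \<le> 34 * sqrt (3 * L / (2 * \<xi>)) \<and>
               w \<in> edom \<psi> \<and> g \<in> subdiff \<psi> w \<and>
               (\<exists>w'\<in>stationary_pts G \<psi>. dual_pnorm P (G w + g) \<le> \<xi> * pnorm P (v - w'))))"

section \<open>Saddle point problems\<close>

record ('a, 'b) sp_instance =
  obj :: "'a \<times> 'b \<Rightarrow> real"
  psi_x :: "'a \<Rightarrow> ereal"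
  psi_y :: "'b \<Rightarrow> ereal"
  init :: "'a \<times> 'b"

definition sp_dom :: "('a, 'b) sp_instance \<Rightarrow> ('a \<times> 'b) set" where
  "sp_dom I = edom (psi_x I) \<times> edom (psi_y I)"

text \<open>Only used on \<^term>\<open>sp_dom I\<close>, where both regularizers are finite.\<close>

definition sp_F :: "('a, 'b) sp_instance \<Rightarrow> 'a \<Rightarrow> 'b \<Rightarrow> real" where
  "sp_F I x y = obj I (x, y) + real_of_ereal (psi_x I x) - real_of_ereal (psi_y I y)"

definition is_saddle_point :: "('a, 'b) sp_instance \<Rightarrow> 'a \<times> 'b \<Rightarrow> bool" where
  "is_saddle_point I z \<longleftrightarrow> z \<in> sp_dom I \<and>
     (\<forall>x\<in>edom (psi_x I). \<forall>y\<in>edom (psi_y I).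
        sp_F I (fst z) y \<le> sp_F I (fst z) (snd z) \<and> sp_F I (fst z) (snd z) \<le> sp_F I x (snd z))"

locale sp_params =
  fixes Px :: "'a::euclidean_space \<Rightarrow> 'a" and Py :: "'b::euclidean_space \<Rightarrow> 'b"
    and Lx Lxy Ly Dx Dy :: real
begin

definition sp_class :: "('a, 'b) sp_instance set" where
  "sp_class = {I.
     init I \<in> sp_dom I \<and>
     (\<forall>y\<in>edom (psi_y I). convex_on (edom (psi_x I)) (\<lambda>x. obj I (x, y))) \<and>
     (\<forall>x\<in>edom (psi_x I). concave_on (edom (psi_y I)) (\<lambda>y. obj I (x, y))) \<and>
     proper_closed_convex (psi_x I) \<and> proper_closed_convex (psi_y I) \<and>
     (\<exists>xs ys. is_saddle_point I (xs, ys) \<and>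
        pnorm Px (fst (init I) - xs) \<le> Dx \<and> pnorm Py (snd (init I) - ys) \<le> Dy) \<and>
     (\<exists>U. open U \<and> sp_dom I \<subseteq> U \<and> C1_on U (obj I)) \<and>
     (\<forall>x\<in>edom (psi_x I). \<forall>x'\<in>edom (psi_x I). \<forall>y\<in>edom (psi_y I). \<forall>y'\<in>edom (psi_y I).
        dual_pnorm Px (grad_x (obj I) (x', y') - grad_x (obj I) (x, y))
          \<le> Lx * pnorm Px (x' - x) + Lxy * pnorm Py (y' - y) \<and>
        dual_pnorm Py (grad_y (obj I) (x', y') - grad_y (obj I) (x, y))
          \<le> Lxy * pnorm Px (x' - x) + Ly * pnorm Py (y' - y))}"

definition sp_ball :: "('a, 'b) sp_instance \<Rightarrow> ('a \<times> 'b) set" where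
  "sp_ball I = {(x, y). pnorm Px (fst (init I) - x) \<le> Dx \<and> pnorm Py (snd (init I) - y) \<le> Dy}"

definition sp_gap :: "('a, 'b) sp_instance \<Rightarrow> 'a \<times> 'b \<Rightarrow> ereal" where
  "sp_gap I zb =
     (SUP (x, y) \<in> sp_ball I \<inter> sp_dom I. ereal (sp_F I (fst zb) y - sp_F I x (snd zb)))"

definition eps_saddle :: "real \<Rightarrow> ('a, 'b) sp_instance \<Rightarrow> 'a \<times> 'b \<Rightarrow> bool" where
  "eps_saddle \<epsilon> I zb \<longleftrightarrow> zb \<in> sp_dom I \<and> sp_gap I zb \<le> ereal \<epsilon>"

end

section \<open>The algorithm\<close>

text \<open>One iteration, started from \<open>v\<^sup>t\<close>, is described by functions of \<open>v = v\<^sup>t\<close>; thus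
  \<open>z_next I (v t)\<close> is \<open>z\<^bsup>t+1\<^esup>\<close>, \<open>V_psi I (v t)\<close> is \<open>V\<^sub>\<psi>(z\<^bsup>t+1\<^esup>)\<close> and \<open>weight I (v t)\<close> is \<open>a\<^bsub>t+1\<^esub>\<close>.\<close>

locale dm_sp = sp_params Px Py Lx Lxy Ly Dx Dy
  for Px :: "'a::euclidean_space \<Rightarrow> 'a" and Py :: "'b::euclidean_space \<Rightarrow> 'b"
    and Lx Lxy Ly Dx Dy :: real +
  fixes \<alpha>x \<alpha>y lam :: real
    and armx :: "'a local_solver" and army :: "'b local_solver"
begin

definition joint_norm :: "'a \<times> 'b \<Rightarrow> real" where
  "joint_norm z = sqrt (\<alpha>x * (pnorm Px (fst z))\<^sup>2 + \<alpha>y * (pnorm Py (snd z))\<^sup>2)"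

definition joint_dual_norm :: "'a \<times> 'b \<Rightarrow> real" where
  "joint_dual_norm g =
     sqrt (inverse \<alpha>x * (dual_pnorm Px (fst g))\<^sup>2 + inverse \<alpha>y * (dual_pnorm Py (snd g))\<^sup>2)"

definition psi_hat_x :: "('a, 'b) sp_instance \<Rightarrow> 'a \<times> 'b \<Rightarrow> 'a \<Rightarrow> ereal" where
  "psi_hat_x I v x = psi_x I x + ereal (\<alpha>x * lam / 2 * (pnorm Px (x - fst v))\<^sup>2)"

definition psi_hat_y :: "('a, 'b) sp_instance \<Rightarrow> 'a \<times> 'b \<Rightarrow> 'b \<Rightarrow> ereal" where
  "psi_hat_y I v y = psi_y I y + ereal (\<alpha>y * lam / 2 * (pnorm Py (y - snd v))\<^sup>2)"

definition local_x :: "('a, 'b) sp_instance \<Rightarrow> 'a \<times> 'b \<Rightarrow> 'a \<times> 'a \<times> nat" where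
  "local_x I v =
     armx (\<lambda>x. grad_x (obj I) (x, snd v)) (psi_hat_x I v) (fst v) (\<alpha>x * lam / 3) Lx"

definition local_y :: "('a, 'b) sp_instance \<Rightarrow> 'a \<times> 'b \<Rightarrow> 'b \<times> 'b \<times> nat" where
  "local_y I v =
     army (\<lambda>y. - grad_y (obj I) (fst v, y)) (psi_hat_y I v) (snd v) (\<alpha>y * lam / 3) Ly"

definition z_next :: "('a, 'b) sp_instance \<Rightarrow> 'a \<times> 'b \<Rightarrow> 'a \<times> 'b" where
  "z_next I v = (fst (local_x I v), fst (local_y I v))"

definition subgrad_x :: "('a, 'b) sp_instance \<Rightarrow> 'a \<times> 'b \<Rightarrow> 'a" where
  "subgrad_x I v = fst (snd (local_x I v)) - (\<alpha>x * lam) *\<^sub>R Px (fst (z_next I v) - fst v)"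

definition subgrad_y :: "('a, 'b) sp_instance \<Rightarrow> 'a \<times> 'b \<Rightarrow> 'b" where
  "subgrad_y I v = fst (snd (local_y I v)) - (\<alpha>y * lam) *\<^sub>R Py (snd (z_next I v) - snd v)"

definition V_psi :: "('a, 'b) sp_instance \<Rightarrow> 'a \<times> 'b \<Rightarrow> 'a \<times> 'b" where
  "V_psi I v = (grad_x (obj I) (z_next I v) + subgrad_x I v,
                - grad_y (obj I) (z_next I v) + subgrad_y I v)"

definition weight :: "('a, 'b) sp_instance \<Rightarrow> 'a \<times> 'b \<Rightarrow> real" where
  "weight I v = 2 * (V_psi I v \<bullet> (v - z_next I v)) / (joint_dual_norm (V_psi I v))\<^sup>2"

text \<open>The candidate after \<open>k \<ge> 1\<close> iterations. If \<open>V\<^sub>\<psi>(z\<^sup>k) = 0\<close>, the quotient defining \<open>a\<^sub>k\<close> is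
  \<open>0/0\<close>; it is then read as \<open>a\<^sub>k = +\<infinity>\<close>, so that the average is \<open>z\<^sup>k\<close>, which is a saddle point.\<close>

definition candidate :: "('a, 'b) sp_instance \<Rightarrow> (nat \<Rightarrow> 'a \<times> 'b) \<Rightarrow> nat \<Rightarrow> 'a \<times> 'b" where
  "candidate I v k =
     (if V_psi I (v (k - 1)) = 0 then z_next I (v (k - 1))
      else inverse (\<Sum>t<k. weight I (v t)) *\<^sub>R (\<Sum>t<k. weight I (v t) *\<^sub>R z_next I (v t)))"

definition prox_objective :: "('a, 'b) sp_instance \<Rightarrow> 'a \<times> 'b \<Rightarrow> 'a \<times> 'b \<Rightarrow> real" where
  "prox_objective I v u = weight I v * (V_psi I v \<bullet> u) + (joint_norm (u - v))\<^sup>2 / 2"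

text \<open>The sequences \<open>v\<^sup>0, v\<^sup>1, \<dots>\<close> produced on \<open>I\<close>. The iterates computed after the candidate has
  become an \<open>\<epsilon>\<close>-saddle point are irrelevant and left unconstrained. Since the domain need not be
  closed, the minimum in the last step need not be attained; there is then no run on \<open>I\<close>.\<close>

definition is_run :: "real \<Rightarrow> ('a, 'b) sp_instance \<Rightarrow> (nat \<Rightarrow> 'a \<times> 'b) \<Rightarrow> bool" where
  "is_run \<epsilon> I v \<longleftrightarrow> v 0 = init I \<and>
     (\<forall>t. (\<forall>k\<in>{1..Suc t}. \<not> eps_saddle \<epsilon> I (candidate I v k)) \<longrightarrow>
          is_arg_min (prox_objective I (v t)) (\<lambda>u. u \<in> sp_dom I) (v (Suc t)))"

text \<open>Every iteration has two communication rounds: the local solves precede the first one, the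
  single gradient query at \<open>z\<^bsup>t+1\<^esup>\<close> precedes the second one, after which the candidate is
  updated.\<close>

definition queries_x :: "('a, 'b) sp_instance \<Rightarrow> (nat \<Rightarrow> 'a \<times> 'b) \<Rightarrow> nat \<Rightarrow> nat" where
  "queries_x I v T = (\<Sum>t<(T + 1) div 2. snd (snd (local_x I (v t)))) + T div 2"

definition queries_y :: "('a, 'b) sp_instance \<Rightarrow> (nat \<Rightarrow> 'a \<times> 'b) \<Rightarrow> nat \<Rightarrow> nat" where
  "queries_y I v T = (\<Sum>t<(T + 1) div 2. snd (snd (local_y I (v t)))) + T div 2"

definition solved_after :: "real \<Rightarrow> ('a, 'b) sp_instance \<Rightarrow> (nat \<Rightarrow> 'a \<times> 'b) \<Rightarrow> nat \<Rightarrow> bool" where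
  "solved_after \<epsilon> I v T \<longleftrightarrow> 2 \<le> T \<and> eps_saddle \<epsilon> I (candidate I v (T div 2))"

definition run_cost ::
  "real \<Rightarrow> real \<Rightarrow> real \<Rightarrow> ('a, 'b) sp_instance \<Rightarrow> (nat \<Rightarrow> 'a \<times> 'b) \<Rightarrow> ereal" where
  "run_cost cx cy \<epsilon> I v =
     (if \<exists>T. solved_after \<epsilon> I v T
      then let T = (LEAST T. solved_after \<epsilon> I v T)
           in ereal (cx * real (queries_x I v T) + cy * real (queries_y I v T))
      else \<infinity>)"

definition oracle_complexity :: "real \<Rightarrow> real \<Rightarrow> real \<Rightarrow> ereal" where
  "oracle_complexity cx cy \<epsilon> =
     (SUP (I, v) \<in> {(I, v). I \<in> sp_class \<and> is_run \<epsilon> I v}. run_cost cx cy \<epsilon> I v)"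

end

end

theory Submission
  imports Defs
begin

text \<open>
  One iteration is an inexact proximal-point step of stepsize \<open>1 / lam\<close> for the monotone operator
  \<open>(\<nabla>\<^sub>x f, - \<nabla>\<^sub>y f) + \<partial>\<psi>\<close>, in which each agent freezes the other's block. With \<open>lam = 2\<close> and
  \<open>\<alpha>x * \<alpha>y = Lxy\<^sup>2\<close> the total error obeys
  \<open>dual_pnorm P (V + lam *\<^sub>R P (z - v)) \<le> lam * pnorm P (z - v)\<close>, where \<open>P\<close> is the form of the
  joint norm. Squaring gives \<open>V \<bullet> (v - z) \<ge> (dual_pnorm P V)\<^sup>2 / (2 * lam)\<close>, that is, all
  weights are at least \<open>1 / 2\<close>. The extragradient-type update telescopes, so after \<open>n\<close> iterations
  the gap is at most \<open>(Lxy * Dx * Dy) / (n / 2)\<close>, and \<open>\<lceil>2 * Lxy * Dx * Dy / \<epsilon>\<rceil>\<close> iterations suffice.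
  Each costs agent \<open>x\<close> one query plus at most \<open>51 * sqrt (Lx * Dx / (Lxy * Dy))\<close> local ones.
\<close>

section \<open>Gradients and convexity\<close>

lemma GDERIV_imp_unique:
  assumes "GDERIV f x :> g" and "GDERIV f x :> h"
  shows "g = h"
proof -
  have "(\<lambda>d. d \<bullet> g) = (\<lambda>d. d \<bullet> h)"
    using assms has_derivative_unique unfolding gderiv_def by blast
  then have "(g - h) \<bullet> g = (g - h) \<bullet> h" by metis
  then show ?thesis by (metis inner_diff_right inner_eq_zero_iff right_minus_eq)
qed

lemma grad_eqI: "GDERIV f x :> g \<Longrightarrow> grad f x = g"
  unfolding grad_def using GDERIV_imp_unique by blast

lemma GDERIV_along_segment:
  assumes "GDERIV f x :> g"
  shows "((\<lambda>s. f (x + s *\<^sub>R d)) has_real_derivative g \<bullet> d) (at 0)"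
proof -
  have "((\<lambda>s::real. x + s *\<^sub>R d) has_derivative (\<lambda>s. s *\<^sub>R d)) (at 0)"
    by (auto intro!: derivative_eq_intros)
  from has_derivative_compose[OF this, of f "\<lambda>h. h \<bullet> g"] assms
  have "((\<lambda>s. f (x + s *\<^sub>R d)) has_derivative (\<lambda>s. s *\<^sub>R d \<bullet> g)) (at 0)"
    by (simp add: gderiv_def)
  moreover have "(\<lambda>s. s *\<^sub>R d \<bullet> g) = (*) (g \<bullet> d)"
    by (simp add: fun_eq_iff inner_commute)
  ultimately show ?thesis by (simp only: has_field_derivative_def)
qed

text \<open>The first-order conditions below reduce to this one-sided test along a segment; the
  cutoff at 1 is the end of a segment inside a convex set.\<close>

lemma right_minimum_derivative_nonneg:
  fixes \<phi> :: "real \<Rightarrow> real"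
  assumes "(\<phi> has_real_derivative D) (at 0)" and "\<And>s. 0 < s \<Longrightarrow> s \<le> 1 \<Longrightarrow> \<phi> 0 \<le> \<phi> s"
  shows "0 \<le> D"
proof (rule ccontr)
  assume "\<not> 0 \<le> D"
  then obtain d where "d > 0" and d: "\<forall>h>0. h < d \<longrightarrow> \<phi> h < \<phi> 0"
    using has_real_derivative_neg_dec_right[OF assms(1)] by auto
  then have "\<phi> (min (d / 2) 1) < \<phi> 0" by (auto simp: min_def)
  moreover have "\<phi> 0 \<le> \<phi> (min (d / 2) 1)" using \<open>d > 0\<close> by (intro assms(2)) auto
  ultimately show False by simp
qed

lemma convex_segment_mem:
  fixes x y :: "'a::real_vector"
  assumes "convex S" "x \<in> S" "y \<in> S" "0 \<le> s" "s \<le> 1"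
  shows "x + s *\<^sub>R (y - x) \<in> S"
proof -
  have "(1 - s) *\<^sub>R x + s *\<^sub>R y \<in> S" using assms by (intro convexD) auto
  then show ?thesis by (simp add: algebra_simps)
qed

lemma constrained_minimizer_gradient:
  assumes "convex S" "z \<in> S" "u \<in> S" "GDERIV f z :> g" "\<And>w. w \<in> S \<Longrightarrow> f z \<le> f w"
  shows "0 \<le> g \<bullet> (u - z)"
  using convex_segment_mem[OF assms(1-3)] assms(5)
  by (intro right_minimum_derivative_nonneg[OF GDERIV_along_segment[OF assms(4)]]) auto

text \<open>The slack of the convexity inequality along the segment vanishes at \<open>s = 0\<close>
  and is nonnegative up to \<open>s = 1\<close>; its derivative at 0 is the slack of the
  claim.\<close>

lemma convex_on_gradient_inequality:
  assumes "convex_on S f" "x \<in> S" "y \<in> S" "GDERIV f x :> g"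
  shows "f x + g \<bullet> (y - x) \<le> f y"
proof -
  have "0 \<le> f y - f x - g \<bullet> (y - x)"
  proof (rule right_minimum_derivative_nonneg)
    show "((\<lambda>s. (1 - s) * f x + s * f y - f (x + s *\<^sub>R (y - x)))
            has_real_derivative f y - f x - g \<bullet> (y - x)) (at 0)"
      by (auto intro!: derivative_eq_intros GDERIV_along_segment[OF assms(4)])
    fix s :: real assume "0 < s" "s \<le> 1"
    then have "f ((1 - s) *\<^sub>R x + s *\<^sub>R y) \<le> (1 - s) * f x + s * f y"
      using assms by (intro convex_onD) auto
    then show "(1 - 0) * f x + 0 * f y - f (x + 0 *\<^sub>R (y - x))
        \<le> (1 - s) * f x + s * f y - f (x + s *\<^sub>R (y - x))"
      by (simp add: algebra_simps)
  qed
  then show ?thesis by simp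
qed

section \<open>Extended-valued convex functions\<close>

lemma edom_add_real: "edom (\<lambda>x. \<psi> x + ereal (q x)) = edom \<psi>"
proof -
  have "\<psi> x + ereal (q x) < \<infinity> \<longleftrightarrow> \<psi> x < \<infinity>" for x by (cases "\<psi> x") auto
  then show ?thesis by (simp add: edom_def)
qed

lemma finite_on_edom:
  assumes "proper_closed_convex \<psi>" "x \<in> edom \<psi>"
  shows "\<psi> x = ereal (real_of_ereal (\<psi> x))"
  using assms by (cases "\<psi> x") (auto simp: proper_closed_convex_def edom_def)

lemma eepigraph_iff:
  assumes "proper_closed_convex \<psi>"
  shows "(x, r) \<in> eepigraph \<psi> \<longleftrightarrow> x \<in> edom \<psi> \<and> real_of_ereal (\<psi> x) \<le> r"
  using assms
  by (cases "\<psi> x") (auto simp: proper_closed_convex_def edom_def eepigraph_def)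

lemma convex_on_real_of_ereal:
  assumes "proper_closed_convex \<psi>"
  shows "convex_on (edom \<psi>) (\<lambda>x. real_of_ereal (\<psi> x))"
proof -
  let ?f = "\<lambda>x. real_of_ereal (\<psi> x)"
  have *: "(u *\<^sub>R x + v *\<^sub>R y, u * ?f x + v * ?f y) \<in> eepigraph \<psi>"
    if "x \<in> edom \<psi>" "y \<in> edom \<psi>" "0 \<le> u" "0 \<le> v" "u + v = 1" for x y u v
  proof -
    have "u *\<^sub>R (x, ?f x) + v *\<^sub>R (y, ?f y) \<in> eepigraph \<psi>"
      using assms that by (intro convexD) (auto simp: eepigraph_iff proper_closed_convex_def)
    then show ?thesis by simp
  qed
  then have "convex (edom \<psi>)"
    by (intro convexI) (use assms eepigraph_iff in blast)
  then show ?thesis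
    unfolding convex_on_def using * assms by (simp add: eepigraph_iff)
qed

lemma convex_edom: "proper_closed_convex \<psi> \<Longrightarrow> convex (edom \<psi>)"
  using convex_on_real_of_ereal convex_on_imp_convex by blast

lemma subdiff_iff:
  assumes "proper_closed_convex \<psi>"
  shows "g \<in> subdiff \<psi> x \<longleftrightarrow> x \<in> edom \<psi> \<and>
           (\<forall>y\<in>edom \<psi>. real_of_ereal (\<psi> x) + g \<bullet> (y - x) \<le> real_of_ereal (\<psi> y))"
proof -
  have "\<psi> x + ereal (g \<bullet> (y - x)) \<le> \<psi> y \<longleftrightarrow>
        (y \<in> edom \<psi> \<longrightarrow> real_of_ereal (\<psi> x) + g \<bullet> (y - x) \<le> real_of_ereal (\<psi> y))"
    if "x \<in> edom \<psi>" for y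
    using assms that
    by (cases "\<psi> x"; cases "\<psi> y") (auto simp: proper_closed_convex_def edom_def)
  then show ?thesis unfolding subdiff_def by blast
qed

text \<open>Minimizing \<open>f + \<psi>\<close> amounts to minimizing the differentiable function
  \<open>f (fst p) + snd p\<close> over the convex epigraph. Its gradient at the graph point is
  \<open>(g, 1)\<close>, and the first-order condition tested on graph points is the subgradient
  inequality.\<close>

lemma minimizer_subdiff:
  assumes \<psi>: "proper_closed_convex \<psi>" and w: "w \<in> edom \<psi>" and g: "GDERIV f w :> g"
    and min: "\<And>y. y \<in> edom \<psi> \<Longrightarrow>
        f w + real_of_ereal (\<psi> w) \<le> f y + real_of_ereal (\<psi> y)"
  shows "- g \<in> subdiff \<psi> w"
proof -
  have "GDERIV (\<lambda>p. f (fst p) + snd p) (w, real_of_ereal (\<psi> w)) :> (g, 1)"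
    unfolding gderiv_def using g[unfolded gderiv_def]
    by (auto intro!: derivative_eq_intros has_derivative_compose[of fst _ _ _ f]
        simp: inner_prod_def fun_eq_iff)
  then have *: "0 \<le> (g, 1) \<bullet> ((y, real_of_ereal (\<psi> y)) - (w, real_of_ereal (\<psi> w)))"
    if "y \<in> edom \<psi>" for y
    by (rule constrained_minimizer_gradient[rotated 3, where S = "eepigraph \<psi>"])
      (use \<psi> w that min in \<open>force simp: proper_closed_convex_def eepigraph_iff\<close>)+
  then have "real_of_ereal (\<psi> w) + - g \<bullet> (y - w) \<le> real_of_ereal (\<psi> y)" if "y \<in> edom \<psi>" for y
    using *[OF that] by (simp add: inner_prod_def)
  then show ?thesis using \<psi> w by (simp add: subdiff_iff)
qed

text \<open>The closed convex epigraph is strictly separated from a point one unit below the graph;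
  dividing by the vertical component of the normal gives the minorant.\<close>

lemma proper_closed_convex_affine_minorant:
  assumes \<psi>: "proper_closed_convex \<psi>"
  obtains a c where "\<And>x. x \<in> edom \<psi> \<Longrightarrow> a \<bullet> x + c \<le> real_of_ereal (\<psi> x)"
proof -
  obtain v where v: "v \<in> edom \<psi>" using \<psi> by (auto simp: proper_closed_convex_def)
  have "(v, real_of_ereal (\<psi> v) - 1) \<notin> eepigraph \<psi>" using \<psi> by (simp add: eepigraph_iff)
  then obtain p b where p: "p \<bullet> (v, real_of_ereal (\<psi> v) - 1) < b"
    and q: "\<And>z. z \<in> eepigraph \<psi> \<Longrightarrow> b < p \<bullet> z"
    using separating_hyperplane_closed_point[of "eepigraph \<psi>"] \<psi>
    unfolding proper_closed_convex_def by metis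
  obtain a \<beta> where ab: "p = (a, \<beta>)" by fastforce
  have q': "b < a \<bullet> x + \<beta> * real_of_ereal (\<psi> x)" if "x \<in> edom \<psi>" for x
    using q[of "(x, real_of_ereal (\<psi> x))"] that \<psi> by (simp add: ab eepigraph_iff)
  \<comment> \<open>At \<open>v\<close> both separation inequalities have the same horizontal part,
    so the strict increase comes from \<open>\<beta>\<close> times one unit of height.\<close>
  have "\<beta> > 0" using p q'[OF v] by (simp add: ab algebra_simps)
  show thesis
  proof (rule that[of "(- 1 / \<beta>) *\<^sub>R a" "b / \<beta>"])
    fix x assume "x \<in> edom \<psi>"
    from q'[OF this] \<open>\<beta> > 0\<close>
    show "(- 1 / \<beta>) *\<^sub>R a \<bullet> x + b / \<beta> \<le> real_of_ereal (\<psi> x)"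
      by (simp add: field_simps)
  qed
qed

text \<open>The new epigraph is the preimage of the old one under a continuous shear, which gives
  closedness. The shear is not affine in general, so convexity uses that of \<open>q\<close>
  separately.\<close>

lemma proper_closed_convex_add_real:
  fixes q :: "'a::euclidean_space \<Rightarrow> real"
  assumes \<psi>: "proper_closed_convex \<psi>" and c: "continuous_on UNIV q" and q: "convex_on UNIV q"
  shows "proper_closed_convex (\<lambda>x. \<psi> x + ereal (q x))"
proof -
  let ?\<psi> = "\<lambda>x. \<psi> x + ereal (q x)"
  have epi: "eepigraph ?\<psi> = (\<lambda>p. (fst p, snd p - q (fst p))) -` eepigraph \<psi>"
  proof -
    have "\<psi> x + ereal (q x) \<le> ereal r \<longleftrightarrow> \<psi> x \<le> ereal (r - q x)" for x r
      by (cases "\<psi> x") auto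
    then show ?thesis by (auto simp: eepigraph_def)
  qed
  have "continuous_on UNIV (\<lambda>p::'a \<times> real. (fst p, snd p - q (fst p)))"
    by (intro continuous_intros continuous_on_compose2[OF c]) auto
  then have "closed (eepigraph ?\<psi>)"
    unfolding epi using \<psi> by (simp add: proper_closed_convex_def closed_vimage)
  moreover have "convex (eepigraph ?\<psi>)"
  proof (rule convexI)
    fix z1 z2 and u v :: real
    assume z: "z1 \<in> eepigraph ?\<psi>" "z2 \<in> eepigraph ?\<psi>" and uv: "0 \<le> u" "0 \<le> v" "u + v = 1"
    obtain x r y s where [simp]: "z1 = (x, r)" "z2 = (y, s)" by fastforce
    have "u *\<^sub>R (x, r - q x) + v *\<^sub>R (y, s - q y) \<in> eepigraph \<psi>"
      using \<psi> z uv by (intro convexD) (auto simp: epi proper_closed_convex_def)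
    moreover have "q (u *\<^sub>R x + v *\<^sub>R y) \<le> u * q x + v * q y"
      using q uv by (simp add: convex_on_def)
    ultimately show "u *\<^sub>R z1 + v *\<^sub>R z2 \<in> eepigraph ?\<psi>"
      using \<psi> by (simp add: epi eepigraph_iff algebra_simps)
  qed
  moreover have "\<psi> x + ereal (q x) \<noteq> -\<infinity>" for x
    using \<psi> by (cases "\<psi> x") (auto simp: proper_closed_convex_def)
  ultimately show ?thesis
    using \<psi> by (simp add: proper_closed_convex_def edom_add_real)
qed

section \<open>Norms of positive definite forms\<close>

locale pos_def_form =
  fixes P :: "'a::euclidean_space \<Rightarrow> 'a"
  assumes self_adjoint_pos_def: "self_adjoint_pos_def P"
begin

lemma linear: "linear P"
  and sym: "P x \<bullet> y = P y \<bullet> x"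
  and pos: "x \<noteq> 0 \<Longrightarrow> 0 < P x \<bullet> x"
  using self_adjoint_pos_def by (auto simp: self_adjoint_pos_def_def inner_commute)

lemmas P_simps = linear_add[OF linear] linear_diff[OF linear] linear_neg[OF linear]
  linear_scale[OF linear] linear_0[OF linear]

lemma nonneg: "0 \<le> P x \<bullet> x"
  using pos[of x] by (cases "x = 0") auto

lemma pnorm_sq: "(pnorm P x)\<^sup>2 = P x \<bullet> x"
  by (simp add: pnorm_def nonneg)

lemma pnorm_nonneg [simp]: "0 \<le> pnorm P x"
  by (simp add: pnorm_def nonneg)

lemma pnorm_0 [simp]: "pnorm P 0 = 0"
  by (simp add: pnorm_def)

lemma pnorm_pos: "x \<noteq> 0 \<Longrightarrow> 0 < pnorm P x"
  by (simp add: pnorm_def pos)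

lemma pnorm_scale: "pnorm P (c *\<^sub>R x) = \<bar>c\<bar> * pnorm P x"
proof -
  have "P (c *\<^sub>R x) \<bullet> (c *\<^sub>R x) = c\<^sup>2 * (P x \<bullet> x)"
    by (simp add: P_simps power2_eq_square)
  then show ?thesis by (simp add: pnorm_def real_sqrt_mult)
qed

lemma pnorm_minus_commute: "pnorm P (x - y) = pnorm P (y - x)"
  using pnorm_scale[of "-1" "x - y"] by simp

lemma pnorm_sq_add: "(pnorm P (x + y))\<^sup>2 = (pnorm P x)\<^sup>2 + 2 * (P x \<bullet> y) + (pnorm P y)\<^sup>2"
  using sym[of y x] by (simp add: pnorm_sq P_simps inner_add_left inner_add_right)

lemma Cauchy_Schwarz: "P x \<bullet> y \<le> pnorm P x * pnorm P y"
proof (cases "y = 0")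
  case False
  define n where "n = pnorm P y"
  have "n > 0" using False by (simp add: n_def pnorm_pos)
  define s where "s = P x \<bullet> y / n\<^sup>2"
  have "0 \<le> (pnorm P (x + (- s) *\<^sub>R y))\<^sup>2" by simp
  also have "\<dots> = (pnorm P x)\<^sup>2 - 2 * s * (P x \<bullet> y) + s\<^sup>2 * n\<^sup>2"
    unfolding pnorm_sq_add pnorm_scale by (simp add: power_mult_distrib n_def)
  also have "\<dots> = (pnorm P x)\<^sup>2 - (P x \<bullet> y)\<^sup>2 / n\<^sup>2"
    using \<open>n > 0\<close> by (simp add: s_def power2_eq_square)
  finally have "(P x \<bullet> y)\<^sup>2 \<le> (pnorm P x * n)\<^sup>2"
    using \<open>n > 0\<close> by (simp add: field_simps)
  then show ?thesis
    unfolding n_def by (rule power2_le_imp_le) simp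
qed simp

lemma pnorm_triangle: "pnorm P (x + y) \<le> pnorm P x + pnorm P y"
proof (rule power2_le_imp_le)
  show "(pnorm P (x + y))\<^sup>2 \<le> (pnorm P x + pnorm P y)\<^sup>2"
    using Cauchy_Schwarz[of x y] by (simp add: pnorm_sq_add power2_sum)
qed simp

text \<open>Writing a dual vector as \<open>P u\<close> turns statements about
  \<open>dual_pnorm\<close> into statements about \<open>pnorm\<close>, by
  \<open>dual_pnorm_P\<close>.\<close>

lemma surjE: obtains u where "g = P u"
proof -
  have "inj P"
    using linear pos by (auto simp: linear_injective_0) (metis inner_zero_left less_irrefl)
  then have "surj P" using linear linear_injective_imp_surjective by blast
  then show thesis using that by blast
qed

lemma dual_pnorm_P [simp]: "dual_pnorm P (P u) = pnorm P u"
  unfolding dual_pnorm_def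
proof (rule cSup_eq_maximum)
  \<comment> \<open>The supremum is attained at the normalized \<open>u\<close>. For
    \<open>u = 0\<close> the convention \<open>1 / 0 = 0\<close> gives \<open>?x = 0\<close>, which
    still attains it.\<close>
  let ?x = "(1 / pnorm P u) *\<^sub>R u"
  have "pnorm P ?x \<le> 1" by (simp add: pnorm_scale)
  moreover have "pnorm P u = P u \<bullet> ?x"
    by (simp add: power2_eq_square flip: pnorm_sq)
  ultimately show "pnorm P u \<in> (\<lambda>x. P u \<bullet> x) ` {x. pnorm P x \<le> 1}" by blast
next
  fix r assume "r \<in> (\<lambda>x. P u \<bullet> x) ` {x. pnorm P x \<le> 1}"
  then obtain x where x: "r = P u \<bullet> x" "pnorm P x \<le> 1" by auto
  then have "r \<le> pnorm P u * pnorm P x" using Cauchy_Schwarz by simp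
  also have "\<dots> \<le> pnorm P u * 1" using x by (intro mult_left_mono) auto
  finally show "r \<le> pnorm P u" by simp
qed

lemma dual_pnorm_nonneg [simp]: "0 \<le> dual_pnorm P g"
  by (rule surjE[of g]) simp

lemma dual_pnorm_scale: "dual_pnorm P (c *\<^sub>R g) = \<bar>c\<bar> * dual_pnorm P g"
  by (rule surjE[of g]) (simp add: pnorm_scale flip: P_simps(4))

lemma dual_pnorm_minus: "dual_pnorm P (- g) = dual_pnorm P g"
  using dual_pnorm_scale[of "-1" g] by simp

lemma dual_pnorm_eq_0: "dual_pnorm P g = 0 \<Longrightarrow> g = 0"
proof (rule surjE[of g])
  fix u assume "dual_pnorm P g = 0" "g = P u"
  then show "g = 0" using pnorm_pos[of u] by (cases "u = 0") (simp_all add: P_simps)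
qed

lemma inner_le_dual_pnorm: "g \<bullet> x \<le> dual_pnorm P g * pnorm P x"
  by (rule surjE[of g]) (simp add: Cauchy_Schwarz)

lemma dual_pnorm_triangle: "dual_pnorm P (g + h) \<le> dual_pnorm P g + dual_pnorm P h"
  by (rule surjE[of g], rule surjE[of h]) (simp add: pnorm_triangle flip: P_simps(1))

lemma dual_pnorm_sq_add_P:
  "(dual_pnorm P (g + P d))\<^sup>2 = (dual_pnorm P g)\<^sup>2 + 2 * (g \<bullet> d) + (pnorm P d)\<^sup>2"
  by (rule surjE[of g]) (simp add: pnorm_sq_add flip: P_simps(1))

text \<open>The form has a positive minimum on the unit sphere, and homogeneity extends the bound.
  It lets the prox term dominate affine functions, so that sublevel sets are bounded.\<close>

lemma coercive: obtains c where "0 < c" "\<And>x. c * (norm x)\<^sup>2 \<le> P x \<bullet> x"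
proof -
  have "continuous_on (sphere 0 1) (\<lambda>x. P x \<bullet> x)"
    using linear by (intro continuous_intros linear_continuous_on) (simp add: linear_linear)
  moreover have "sphere (0::'a) 1 \<noteq> {}" by simp
  ultimately obtain w where w: "w \<in> sphere 0 1" "\<And>x. x \<in> sphere 0 1 \<Longrightarrow> P w \<bullet> w \<le> P x \<bullet> x"
    using continuous_attains_inf[OF compact_sphere] by blast
  show thesis
  proof (rule that[of "P w \<bullet> w"])
    show "0 < P w \<bullet> w" using w(1) by (intro pos) auto
    fix x show "P w \<bullet> w * (norm x)\<^sup>2 \<le> P x \<bullet> x"
    proof (cases "x = 0")
      case False
      then have "P w \<bullet> w \<le> P ((1 / norm x) *\<^sub>R x) \<bullet> ((1 / norm x) *\<^sub>R x)"
        by (intro w(2)) simp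
      then show ?thesis using False by (simp add: P_simps field_simps power2_eq_square)
    qed simp
  qed
qed

section \<open>The quadratic proximal term\<close>

definition prox_term :: "real \<Rightarrow> 'a \<Rightarrow> 'a \<Rightarrow> real" where
  "prox_term \<mu> v x = \<mu> / 2 * (pnorm P (x - v))\<^sup>2"

lemma continuous_on_prox_term: "continuous_on S (prox_term \<mu> v)"
proof -
  have "continuous_on UNIV P"
    using linear by (intro linear_continuous_on) (simp add: linear_linear)
  then have "continuous_on S (\<lambda>x. P (x - v))"
    by (rule continuous_on_compose2) (auto intro!: continuous_intros)
  then show ?thesis
    unfolding prox_term_def pnorm_sq by (intro continuous_intros)
qed

lemma GDERIV_prox_term: "GDERIV (prox_term \<mu> v) x :> \<mu> *\<^sub>R P (x - v)"
proof -
  have "bounded_linear P" using linear by (simp add: linear_linear)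
  then have "((\<lambda>x. P (x - v)) has_derivative P) (at x)"
    by (rule bounded_linear.has_derivative) (auto intro!: derivative_eq_intros)
  then have "((\<lambda>x. P (x - v) \<bullet> (x - v)) has_derivative
      (\<lambda>h. P (x - v) \<bullet> h + P h \<bullet> (x - v))) (at x)"
    by (rule has_derivative_inner) (auto intro!: derivative_eq_intros)
  then have "(prox_term \<mu> v has_derivative
      (\<lambda>h. \<mu> / 2 * (P (x - v) \<bullet> h + P h \<bullet> (x - v)))) (at x)"
    unfolding prox_term_def pnorm_sq by (rule has_derivative_mult_right)
  moreover have "\<mu> / 2 * (P (x - v) \<bullet> h + P h \<bullet> (x - v)) = h \<bullet> (\<mu> *\<^sub>R P (x - v))" for h
    using sym[of h "x - v"] by (simp add: inner_commute)
  ultimately show ?thesis unfolding gderiv_def by (simp only:)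
qed

lemma convex_on_prox_term:
  assumes "0 \<le> \<mu>"
  shows "convex_on UNIV (prox_term \<mu> v)"
proof -
  have *: "(pnorm P (a *\<^sub>R x + b *\<^sub>R y - v))\<^sup>2
      \<le> a * (pnorm P (x - v))\<^sup>2 + b * (pnorm P (y - v))\<^sup>2"
    if "0 \<le> a" "0 \<le> b" "a + b = 1" for a b x y
  proof -
    have v: "a *\<^sub>R x + b *\<^sub>R y - v = a *\<^sub>R (x - v) + b *\<^sub>R (y - v)"
      using that(3) by (simp add: algebra_simps flip: scaleR_left_distrib)
    have b: "b = 1 - a" using that by simp
    \<comment> \<open>The convexity slack of the squared norm is exactly \<open>a * b\<close> times
      the squared norm of the difference.\<close>
    have "0 \<le> a * b * (pnorm P ((x - v) + (- 1) *\<^sub>R (y - v)))\<^sup>2" using that by simp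
    then show ?thesis
      unfolding v pnorm_sq_add pnorm_scale power_mult_distrib P_simps inner_scaleR_right
      by (simp add: b P_simps algebra_simps power2_eq_square)
  qed
  then have "prox_term \<mu> v (a *\<^sub>R x + b *\<^sub>R y) \<le> a * prox_term \<mu> v x + b * prox_term \<mu> v y"
    if "0 \<le> a" "0 \<le> b" "a + b = 1" for a b x y
    using mult_left_mono[OF *[OF that, of x y], of "\<mu> / 2"] assms
    by (simp add: prox_term_def distrib_left mult.left_commute)
  then show ?thesis by (simp add: convex_on_def)
qed

section \<open>One inexact proximal step\<close>

text \<open>Forward, \<open>w\<close> minimizes \<open>\<psi>\<close> plus a differentiable
  function, so \<open>minimizer_subdiff\<close> applies; backward, the gradient inequality of the
  prox term is added. This makes \<open>subgrad_x\<close> and \<open>subgrad_y\<close> subgradients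
  of the original regularizers.\<close>

lemma subdiff_add_prox_term:
  assumes \<psi>: "proper_closed_convex \<psi>" and \<mu>: "0 \<le> \<mu>"
  shows "g \<in> subdiff (\<lambda>x. \<psi> x + ereal (prox_term \<mu> v x)) w \<longleftrightarrow>
         g - \<mu> *\<^sub>R P (w - v) \<in> subdiff \<psi> w"
    (is "g \<in> subdiff ?\<psi> w \<longleftrightarrow> _")
proof -
  have pcc: "proper_closed_convex ?\<psi>"
    using \<psi> \<mu> by (intro proper_closed_convex_add_real continuous_on_prox_term convex_on_prox_term)
  have re: "real_of_ereal (?\<psi> y) = real_of_ereal (\<psi> y) + prox_term \<mu> v y" if "y \<in> edom \<psi>" for y
    using finite_on_edom[OF \<psi> that] by (metis plus_ereal.simps(1) real_of_ereal.simps(1))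
  have prox: "prox_term \<mu> v w + (\<mu> *\<^sub>R P (w - v)) \<bullet> (y - w) \<le> prox_term \<mu> v y" for y
    by (rule convex_on_gradient_inequality[OF convex_on_prox_term[OF \<mu>] _ _ GDERIV_prox_term]) auto
  show ?thesis
  proof
    assume g: "g \<in> subdiff ?\<psi> w"
    then have w: "w \<in> edom \<psi>" by (simp add: subdiff_iff[OF pcc] edom_add_real)
    have "GDERIV (\<lambda>y. g \<bullet> y) w :> g"
      by (auto simp: gderiv_def inner_commute intro!: derivative_eq_intros)
    then have "GDERIV (\<lambda>y. prox_term \<mu> v y - g \<bullet> y) w :> \<mu> *\<^sub>R P (w - v) - g"
      by (intro GDERIV_diff GDERIV_prox_term)
    moreover have "prox_term \<mu> v w - g \<bullet> w + real_of_ereal (\<psi> w)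
        \<le> prox_term \<mu> v y - g \<bullet> y + real_of_ereal (\<psi> y)" if "y \<in> edom \<psi>" for y
      using g that w re by (fastforce simp: subdiff_iff[OF pcc] edom_add_real inner_diff_right)
    ultimately have "- (\<mu> *\<^sub>R P (w - v) - g) \<in> subdiff \<psi> w"
      by (rule minimizer_subdiff[OF \<psi> w])
    then show "g - \<mu> *\<^sub>R P (w - v) \<in> subdiff \<psi> w" by simp
  next
    assume g: "g - \<mu> *\<^sub>R P (w - v) \<in> subdiff \<psi> w"
    then have w: "w \<in> edom \<psi>" by (simp add: subdiff_iff[OF \<psi>])
    have "real_of_ereal (?\<psi> w) + g \<bullet> (y - w) \<le> real_of_ereal (?\<psi> y)" if y: "y \<in> edom \<psi>" for y
    proof -
      have "real_of_ereal (\<psi> w) + (g - \<mu> *\<^sub>R P (w - v)) \<bullet> (y - w) \<le> real_of_ereal (\<psi> y)"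
        using g y by (simp add: subdiff_iff[OF \<psi>])
      then show ?thesis
        unfolding re[OF y] re[OF w] using prox[of y] by (simp add: inner_diff_left)
    qed
    then show "g \<in> subdiff ?\<psi> w" using w by (simp add: subdiff_iff[OF pcc] edom_add_real)
  qed
qed

text \<open>The domain of \<open>\<psi>\<close> need not be closed, so the extreme value theorem is
  applied to a compact piece of the epigraph. Boundedness holds because the prox term outgrows the
  affine minorants of \<open>f\<close> and \<open>\<psi>\<close>.\<close>

lemma prox_minimizer_exists:
  assumes \<psi>: "proper_closed_convex \<psi>" and f: "continuous_on (edom \<psi>) f"
    and v: "v \<in> edom \<psi>" and \<mu>: "0 < \<mu>"
    and minorant: "\<And>x. x \<in> edom \<psi> \<Longrightarrow> f v + g \<bullet> (x - v) \<le> f x"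
  obtains w where "w \<in> edom \<psi>" "\<And>y. y \<in> edom \<psi> \<Longrightarrow>
     f w + prox_term \<mu> v w + real_of_ereal (\<psi> w) \<le> f y + prox_term \<mu> v y + real_of_ereal (\<psi> y)"
proof -
  let ?r = "\<lambda>x. real_of_ereal (\<psi> x)"
  define h where "h x = f x + prox_term \<mu> v x + ?r x" for x
  obtain a c where ac: "\<And>x. x \<in> edom \<psi> \<Longrightarrow> a \<bullet> x + c \<le> ?r x"
    using proper_closed_convex_affine_minorant[OF \<psi>] by metis
  obtain e where e: "0 < e" "\<And>x. e * (norm x)\<^sup>2 \<le> P x \<bullet> x" using coercive by metis
  define b where "b = norm (a + g)"
  define k where "k = f v + a \<bullet> v + c"
  define e' where "e' = \<mu> / 2 * e"
  have e': "0 < e'" using e \<mu> by (simp add: e'_def)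
  \<comment> \<open>Beyond this radius the quadratic in \<open>h_lower\<close> pushes
    \<open>h\<close> above \<open>h v\<close>; the \<open>max 1\<close> lets the constant be
    absorbed into the linear term.\<close>
  define R where "R = max 1 ((b + \<bar>h v - k\<bar>) / e')"
  have h_lower: "k - b * norm (x - v) + e' * (norm (x - v))\<^sup>2 \<le> h x" if "x \<in> edom \<psi>" for x
  proof -
    have "- (b * norm (x - v)) \<le> (a + g) \<bullet> (x - v)"
      unfolding b_def using norm_cauchy_schwarz[of "- (a + g)" "x - v"]
      by (simp only: inner_minus_left norm_minus_cancel)
    moreover have "e' * (norm (x - v))\<^sup>2 \<le> prox_term \<mu> v x"
      using e(2)[of "x - v"] \<mu> by (simp add: e'_def prox_term_def pnorm_sq)
    ultimately show ?thesis
      using ac[OF that] minorant[OF that]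
      by (simp add: h_def k_def inner_add_left inner_diff_right algebra_simps)
  qed
  have bounded: "norm (x - v) \<le> R" if "x \<in> edom \<psi>" "h x \<le> h v" for x
  proof (cases "norm (x - v) \<le> 1")
    case False
    define r where "r = norm (x - v)"
    have r: "1 < r" using False by (simp add: r_def)
    have "e' * r * r \<le> b * r + (h v - k)"
      using h_lower[OF that(1)] that(2) by (simp add: r_def power2_eq_square mult.assoc)
    also have "\<dots> \<le> b * r + \<bar>h v - k\<bar> * r"
      using r mult_left_mono[of 1 r "\<bar>h v - k\<bar>"] by simp
    finally have "e' * r * r \<le> (b + \<bar>h v - k\<bar>) * r" by (simp add: distrib_right)
    then have "e' * r \<le> b + \<bar>h v - k\<bar>" using r by simp
    then have "r \<le> (b + \<bar>h v - k\<bar>) / e'" using e' by (simp add: field_simps)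
    then show ?thesis by (simp add: r_def R_def)
  qed (simp add: R_def)
  \<comment> \<open>\<open>m\<close> and \<open>M\<close> enclose the values of
    \<open>\<psi>\<close> on the sublevel set: \<open>m\<close> comes from the minorant of
    \<open>\<psi>\<close>, \<open>M\<close> from that of \<open>f\<close>.\<close>
  define m where "m = a \<bullet> v + c - norm a * R"
  define M where "M = h v - f v + norm g * R"
  have cs: "- (norm u * R) \<le> u \<bullet> (x - v)" if "norm (x - v) \<le> R" for u x
  proof -
    have "- u \<bullet> (x - v) \<le> norm u * norm (x - v)"
      using norm_cauchy_schwarz[of "- u" "x - v"] by simp
    also have "\<dots> \<le> norm u * R" using that by (intro mult_left_mono) auto
    finally show ?thesis by simp
  qed
  define S where "S = eepigraph \<psi> \<inter> (cball v R \<times> {m..M})"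
  have sub: "(x, ?r x) \<in> S" if "x \<in> edom \<psi>" "h x \<le> h v" for x
  proof -
    have R: "norm (x - v) \<le> R" by (rule bounded[OF that])
    have "m \<le> ?r x"
      using cs[OF R, of a] ac[OF that(1)] by (simp add: m_def inner_diff_right)
    moreover have "0 \<le> prox_term \<mu> v x" using \<mu> by (simp add: prox_term_def)
    then have "?r x \<le> M"
      using cs[OF R, of g] minorant[OF that(1)] that(2) unfolding M_def by (simp add: h_def)
    ultimately show ?thesis
      using that R \<psi> by (simp add: S_def eepigraph_iff dist_norm norm_minus_commute)
  qed
  have "compact S"
    unfolding S_def using \<psi>
    by (intro closed_Int_compact compact_Times compact_cball compact_Icc)
      (simp add: proper_closed_convex_def)
  moreover have "S \<noteq> {}" using sub[OF v] by auto
  moreover have cont: "continuous_on S (\<lambda>p. f (fst p) + prox_term \<mu> v (fst p) + snd p)"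
  proof (intro continuous_on_add)
    show "continuous_on S (\<lambda>p. f (fst p))"
      by (rule continuous_on_compose2[OF f])
        (use \<psi> in \<open>auto simp: S_def eepigraph_iff intro: continuous_on_fst continuous_on_id\<close>)
    show "continuous_on S (\<lambda>p. prox_term \<mu> v (fst p))"
      by (rule continuous_on_compose2[OF continuous_on_prox_term[of UNIV]])
        (auto intro: continuous_on_fst continuous_on_id)
  qed (intro continuous_intros)
  ultimately have "\<exists>p\<in>S. \<forall>q\<in>S. f (fst p) + prox_term \<mu> v (fst p) + snd p
                 \<le> f (fst q) + prox_term \<mu> v (fst q) + snd q"
    by (rule continuous_attains_inf)
  then obtain p where p: "p \<in> S"
    and min: "\<And>q. q \<in> S \<Longrightarrow> f (fst p) + prox_term \<mu> v (fst p) + snd p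
                 \<le> f (fst q) + prox_term \<mu> v (fst q) + snd q"
    by blast
  obtain w r where w: "p = (w, r)" by fastforce
  \<comment> \<open>The height \<open>r\<close> may lie above the graph; lowering it to
    \<open>?r w\<close> can only decrease the objective.\<close>
  have we: "w \<in> edom \<psi>" "?r w \<le> r" using p \<psi> by (simp_all add: w S_def eepigraph_iff)
  have le: "h w \<le> h y" if "y \<in> edom \<psi>" "h y \<le> h v" for y
    using min[OF sub[OF that]] we(2) by (simp add: w h_def)
  have "h w \<le> h y" if "y \<in> edom \<psi>" for y
    using le[OF that] le[OF v] by linarith
  then show thesis using that we(1) by (simp add: h_def)
qed

text \<open>The prox term makes the subproblem \<open>\<mu>\<close>-strongly monotone, so an approximate stationary point
  \<open>w\<close> is no farther from the exact one \<open>w'\<close> than \<open>1 / 3\<close> of the distance from \<open>v\<close> to \<open>w'\<close>. Hence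
  the accuracy \<open>\<mu> / 3 * pnorm P (v - w')\<close> is at most \<open>\<mu> / 2 * pnorm P (w - v)\<close>.\<close>

lemma ARM_prox_step:
  assumes S: "ARM_guarantee P S" and U: "open U" "edom \<psi> \<subseteq> U" and C1: "C1_on U f"
    and f: "convex_on (edom \<psi>) f" and \<psi>: "proper_closed_convex \<psi>"
    and G: "\<And>w. w \<in> U \<Longrightarrow> G w = grad f w"
    and lip: "\<And>w w'. w \<in> edom \<psi> \<Longrightarrow> w' \<in> edom \<psi> \<Longrightarrow>
        dual_pnorm P (G w' - G w) \<le> L * pnorm P (w' - w)"
    and v: "v \<in> edom \<psi>" and \<mu>: "0 < \<mu>" and L: "0 < L"
    and res: "S G (\<lambda>x. \<psi> x + ereal (prox_term \<mu> v x)) v (\<mu> / 3) L = (w, g, n)"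
  shows "real n \<le> 34 * sqrt (9 * L / (2 * \<mu>))" and "w \<in> edom \<psi>"
    and "g - \<mu> *\<^sub>R P (w - v) \<in> subdiff \<psi> w"
    and "dual_pnorm P (G w + g) \<le> \<mu> / 2 * pnorm P (w - v)"
proof -
  let ?\<psi> = "\<lambda>x. \<psi> x + ereal (prox_term \<mu> v x)"
  have pcc: "proper_closed_convex ?\<psi>"
    using \<psi> \<mu> by (intro proper_closed_convex_add_real continuous_on_prox_term convex_on_prox_term) auto
  note sub_iff = subdiff_add_prox_term[OF \<psi> less_imp_le[OF \<mu>]]
  have deriv: "GDERIV f x :> G x" if "x \<in> edom \<psi>" for x
    using C1 U G that by (auto simp: C1_on_def)
  note grad_ineq = convex_on_gradient_inequality[OF f _ _ deriv]
  have mono: "0 \<le> (G y - G x) \<bullet> (y - x)" if "x \<in> edom \<psi>" "y \<in> edom \<psi>" for x y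
    using grad_ineq[OF that that(1)] grad_ineq[OF that(2,1,2)]
    by (simp add: inner_diff_left inner_diff_right)
  have "continuous_on (edom \<psi>) f"
    using deriv by (intro continuous_at_imp_continuous_on ballI has_derivative_continuous)
      (auto simp: gderiv_def)
  then obtain w0 where w0: "w0 \<in> edom \<psi>" and min: "\<And>y. y \<in> edom \<psi> \<Longrightarrow>
     f w0 + prox_term \<mu> v w0 + real_of_ereal (\<psi> w0) \<le> f y + prox_term \<mu> v y + real_of_ereal (\<psi> y)"
    using prox_minimizer_exists[OF \<psi> _ v \<mu>, of f "G v"] grad_ineq[OF v _ v] by metis
  \<comment> \<open>The exact minimizer supplies the stationary point whose existence the solver
    guarantee presupposes.\<close>
  have "- (G w0 + \<mu> *\<^sub>R P (w0 - v)) \<in> subdiff \<psi> w0"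
    using GDERIV_add[OF deriv[OF w0] GDERIV_prox_term] min
    by (rule minimizer_subdiff[OF \<psi> w0])
  then have "- G w0 \<in> subdiff ?\<psi> w0" by (simp add: sub_iff)
  then have "stationary_pts G ?\<psi> \<noteq> {}" unfolding stationary_pts_def by force
  moreover have "\<forall>x\<in>edom ?\<psi>. \<forall>y\<in>edom ?\<psi>. 0 \<le> (G y - G x) \<bullet> (y - x)"
    "\<forall>x\<in>edom ?\<psi>. \<forall>y\<in>edom ?\<psi>. dual_pnorm P (G y - G x) \<le> L * pnorm P (y - x)"
    "edom ?\<psi> \<subseteq> U" "v \<in> edom ?\<psi>" "0 < \<mu> / 3" "\<forall>x\<in>U. G x = grad f x"
    using mono lip U v \<mu> G by (simp_all add: edom_add_real)
  ultimately have "case S G ?\<psi> v (\<mu> / 3) L of (w, g, n) \<Rightarrow>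
               real n \<le> 34 * sqrt (3 * L / (2 * (\<mu> / 3))) \<and>
               w \<in> edom ?\<psi> \<and> g \<in> subdiff ?\<psi> w \<and>
               (\<exists>w'\<in>stationary_pts G ?\<psi>. dual_pnorm P (G w + g) \<le> \<mu> / 3 * pnorm P (v - w'))"
    by (intro S[unfolded ARM_guarantee_def, rule_format, of U ?\<psi> f G L v "\<mu> / 3"]
        conjI U(1) C1 pcc L)
  then obtain w' where n: "real n \<le> 34 * sqrt (3 * L / (2 * (\<mu> / 3)))" and w: "w \<in> edom \<psi>"
    and g: "g \<in> subdiff ?\<psi> w" and w': "w' \<in> stationary_pts G ?\<psi>"
    and acc: "dual_pnorm P (G w + g) \<le> \<mu> / 3 * pnorm P (v - w')"
    unfolding res by (auto simp: edom_add_real)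
  show "real n \<le> 34 * sqrt (9 * L / (2 * \<mu>))" using n by (simp add: field_simps)
  show "w \<in> edom \<psi>" by (rule w)
  show sg: "g - \<mu> *\<^sub>R P (w - v) \<in> subdiff \<psi> w" using g by (simp add: sub_iff)
  obtain g' where "g' \<in> subdiff ?\<psi> w'" "G w' + g' = 0"
    using w' by (auto simp: stationary_pts_def)
  then have sg': "- G w' - \<mu> *\<^sub>R P (w' - v) \<in> subdiff \<psi> w'"
    by (simp add: sub_iff add_eq_0_iff)
  then have w'e: "w' \<in> edom \<psi>" by (simp add: subdiff_iff[OF \<psi>])
  let ?d = "w - w'"
  \<comment> \<open>Monotonicity of the subdifferential, from adding the two subgradient
    inequalities. The terms with \<open>P\<close> then combine into the strongly monotone
    part.\<close>
  have "0 \<le> ((g - \<mu> *\<^sub>R P (w - v)) - (- G w' - \<mu> *\<^sub>R P (w' - v))) \<bullet> ?d"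
    using sg sg' w w'e subdiff_iff[OF \<psi>] by (fastforce simp: inner_diff_left inner_diff_right)
  moreover have "P (w - v) - P (w' - v) = P ?d" by (simp flip: P_simps(2))
  then have "((g - \<mu> *\<^sub>R P (w - v)) - (- G w' - \<mu> *\<^sub>R P (w' - v))) = (G w' + g) - \<mu> *\<^sub>R P ?d"
    by (simp add: algebra_simps flip: scaleR_diff_right)
  ultimately have "\<mu> * (pnorm P ?d)\<^sup>2 \<le> (G w' + g) \<bullet> ?d"
    by (simp add: pnorm_sq inner_diff_left)
  \<comment> \<open>Monotonicity of \<open>G\<close> moves the gradient to the approximate solution,
    where the accuracy is known.\<close>
  also have "\<dots> \<le> (G w + g) \<bullet> ?d"
    using mono[OF w'e w] by (simp add: inner_diff_left inner_add_left)
  also have "\<dots> \<le> dual_pnorm P (G w + g) * pnorm P ?d" by (rule inner_le_dual_pnorm)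
  also have "\<dots> \<le> \<mu> / 3 * pnorm P (v - w') * pnorm P ?d"
    using acc by (intro mult_right_mono) auto
  finally have "\<mu> * (pnorm P ?d * pnorm P ?d) \<le> \<mu> * (1 / 3 * pnorm P (v - w') * pnorm P ?d)"
    by (simp add: power2_eq_square)
  then have "pnorm P ?d * pnorm P ?d \<le> 1 / 3 * pnorm P (v - w') * pnorm P ?d"
    using \<mu> by (rule mult_left_le_imp_le)
  then have "pnorm P ?d \<le> 1 / 3 * pnorm P (v - w')"
    using pnorm_nonneg[of ?d] by (cases "pnorm P ?d = 0") (auto simp: less_le)
  moreover have "pnorm P (v - w') \<le> pnorm P (w - v) + pnorm P ?d"
    using pnorm_triangle[of "v - w" ?d] by (simp add: pnorm_minus_commute)
  ultimately have "pnorm P (v - w') \<le> 3 / 2 * pnorm P (w - v)" by simp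
  then have "\<mu> / 3 * pnorm P (v - w') \<le> \<mu> / 3 * (3 / 2 * pnorm P (w - v))"
    using \<mu> by (intro mult_left_mono) auto
  then show "dual_pnorm P (G w + g) \<le> \<mu> / 2 * pnorm P (w - v)" using acc by simp
qed

text \<open>First-order optimality of \<open>w\<close> is tested at \<open>u\<close>; expanding
  \<open>u - v = (w - v) + (u - w)\<close> converts the inner product into the three squared
  distances.\<close>

lemma prox_three_point:
  assumes Q: "convex Q" "w \<in> Q" "u \<in> Q"
    and min: "\<And>y. y \<in> Q \<Longrightarrow> p \<bullet> w + (pnorm P (w - v))\<^sup>2 / 2 \<le> p \<bullet> y + (pnorm P (y - v))\<^sup>2 / 2"
  shows "p \<bullet> (w - u) \<le> (pnorm P (u - v))\<^sup>2 / 2 - (pnorm P (u - w))\<^sup>2 / 2 - (pnorm P (w - v))\<^sup>2 / 2"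
proof -
  have "GDERIV (\<lambda>y. p \<bullet> y) w :> p"
    by (auto simp: gderiv_def inner_commute intro!: derivative_eq_intros)
  from GDERIV_add[OF this GDERIV_prox_term[of 1 v]]
  have "0 \<le> (p + 1 *\<^sub>R P (w - v)) \<bullet> (u - w)"
    by (rule constrained_minimizer_gradient[OF Q]) (use min in \<open>simp add: prox_term_def\<close>)
  moreover have "(pnorm P (u - v))\<^sup>2
      = (pnorm P (w - v))\<^sup>2 + 2 * (P (w - v) \<bullet> (u - w)) + (pnorm P (u - w))\<^sup>2"
    using pnorm_sq_add[of "w - v" "u - w"] by simp
  ultimately show ?thesis by (simp add: inner_add_left inner_diff_right field_simps)
qed

end

section \<open>Partial gradients\<close>

lemma GDERIV_slice_fst:
  assumes "GDERIV f (x, y) :> g"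
  shows "GDERIV (\<lambda>x. f (x, y)) x :> fst g"
proof -
  have "((\<lambda>x. (x, y)) has_derivative (\<lambda>h. (h, 0))) (at x)"
    by (auto intro!: derivative_eq_intros)
  from has_derivative_compose[OF this assms[unfolded gderiv_def]]
  show ?thesis by (simp add: gderiv_def inner_prod_def)
qed

lemma GDERIV_slice_snd:
  assumes "GDERIV f (x, y) :> g"
  shows "GDERIV (\<lambda>y. f (x, y)) y :> snd g"
proof -
  have "((\<lambda>y. (x, y)) has_derivative (\<lambda>h. (0, h))) (at y)"
    by (auto intro!: derivative_eq_intros)
  from has_derivative_compose[OF this assms[unfolded gderiv_def]]
  show ?thesis by (simp add: gderiv_def inner_prod_def)
qed

lemma C1_onI:
  assumes "\<And>z. z \<in> U \<Longrightarrow> GDERIV f z :> g z" and "continuous_on U g"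
  shows "C1_on U f"
proof -
  have "grad f z = g z" if "z \<in> U" for z using assms(1)[OF that] by (rule grad_eqI)
  then show ?thesis using assms by (simp add: C1_on_def cong: continuous_on_cong)
qed

lemma C1_on_slice_fst:
  assumes "C1_on U f"
  shows "C1_on {x. (x, y) \<in> U} (\<lambda>x. f (x, y))"
proof (rule C1_onI)
  show "GDERIV (\<lambda>x. f (x, y)) x :> fst (grad f (x, y))" if "x \<in> {x. (x, y) \<in> U}" for x
    using that assms by (intro GDERIV_slice_fst) (auto simp: C1_on_def)
  show "continuous_on {x. (x, y) \<in> U} (\<lambda>x. fst (grad f (x, y)))"
  proof (rule continuous_on_fst, rule continuous_on_compose2[of U "grad f"])
    show "continuous_on {x. (x, y) \<in> U} (\<lambda>x. (x, y))"
      by (intro continuous_on_Pair continuous_on_id continuous_on_const)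
  qed (use assms in \<open>auto simp: C1_on_def\<close>)
qed

lemma C1_on_slice_snd:
  assumes "C1_on U f"
  shows "C1_on {y. (x, y) \<in> U} (\<lambda>y. f (x, y))"
proof (rule C1_onI)
  show "GDERIV (\<lambda>y. f (x, y)) y :> snd (grad f (x, y))" if "y \<in> {y. (x, y) \<in> U}" for y
    using that assms by (intro GDERIV_slice_snd) (auto simp: C1_on_def)
  show "continuous_on {y. (x, y) \<in> U} (\<lambda>y. snd (grad f (x, y)))"
  proof (rule continuous_on_snd, rule continuous_on_compose2[of U "grad f"])
    show "continuous_on {y. (x, y) \<in> U} (\<lambda>y. (x, y))"
      by (intro continuous_on_Pair continuous_on_id continuous_on_const)
  qed (use assms in \<open>auto simp: C1_on_def\<close>)
qed

lemma grad_uminus: "C1_on U f \<Longrightarrow> z \<in> U \<Longrightarrow> grad (\<lambda>x. - f x) z = - grad f z"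
  by (intro grad_eqI GDERIV_minus) (simp add: C1_on_def)

lemma C1_on_uminus:
  assumes "C1_on U f"
  shows "C1_on U (\<lambda>x. - f x)"
  using assms by (intro C1_onI[of _ _ "\<lambda>x. - grad f x"] GDERIV_minus continuous_on_minus)
    (auto simp: C1_on_def)

section \<open>The joint space\<close>

text \<open>The form inducing \<open>joint_norm\<close>. It makes the product space another instance
  of \<open>pos_def_form\<close>, so norm and prox facts carry over to pairs.\<close>

definition joint_form ::
  "real \<Rightarrow> ('a::euclidean_space \<Rightarrow> 'a) \<Rightarrow> real \<Rightarrow> ('b::euclidean_space \<Rightarrow> 'b) \<Rightarrow> 'a \<times> 'b \<Rightarrow> 'a \<times> 'b"
  where "joint_form a P b R z = (a *\<^sub>R P (fst z), b *\<^sub>R R (snd z))"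

lemma pos_def_form_joint:
  fixes P :: "'a::euclidean_space \<Rightarrow> 'a" and R :: "'b::euclidean_space \<Rightarrow> 'b"
  assumes "pos_def_form P" "pos_def_form R" "0 < a" "0 < b"
  shows "pos_def_form (joint_form a P b R)"
proof -
  interpret P: pos_def_form P by fact
  interpret R: pos_def_form R by fact
  have "linear (joint_form a P b R)"
    by (rule linearI) (simp_all add: joint_form_def P.P_simps R.P_simps scaleR_right_distrib)
  moreover have "joint_form a P b R z \<bullet> w = z \<bullet> joint_form a P b R w" for z w
    using P.sym[of "fst z" "fst w"] R.sym[of "snd z" "snd w"]
    by (simp add: joint_form_def inner_prod_def inner_commute)
  moreover have "0 < joint_form a P b R z \<bullet> z" if "z \<noteq> 0" for z
  proof -
    have "fst z \<noteq> 0 \<or> snd z \<noteq> 0" using that by (simp add: prod_eq_iff)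
    then show ?thesis
      using P.pos[of "fst z"] P.nonneg[of "fst z"] R.pos[of "snd z"] R.nonneg[of "snd z"] assms(3,4)
      by (auto simp: joint_form_def inner_prod_def intro: add_pos_nonneg add_nonneg_pos)
  qed
  ultimately show ?thesis by (simp add: pos_def_form_def self_adjoint_pos_def_def)
qed

lemma pnorm_joint_sq:
  assumes "pos_def_form P" "pos_def_form R" "0 < a" "0 < b"
  shows "(pnorm (joint_form a P b R) z)\<^sup>2 = a * (pnorm P (fst z))\<^sup>2 + b * (pnorm R (snd z))\<^sup>2"
  using assms pos_def_form_joint[OF assms]
  by (simp add: pos_def_form.pnorm_sq joint_form_def inner_prod_def)

text \<open>For \<open>g\<close> the image of \<open>u\<close>, the first block
  \<open>a *\<^sub>R P (fst u)\<close> has dual norm \<open>a\<close> times a primal norm; squaring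
  and multiplying by \<open>inverse a\<close> leaves the primal weight \<open>a\<close>. The second
  block is analogous.\<close>

lemma dual_pnorm_joint_sq:
  assumes "pos_def_form P" "pos_def_form R" "0 < a" "0 < b"
  shows "(dual_pnorm (joint_form a P b R) g)\<^sup>2
       = inverse a * (dual_pnorm P (fst g))\<^sup>2 + inverse b * (dual_pnorm R (snd g))\<^sup>2"
proof -
  note J = pos_def_form_joint[OF assms]
  obtain u where g: "g = joint_form a P b R u" using pos_def_form.surjE[OF J] by metis
  have "inverse c * (\<bar>c\<bar> * n)\<^sup>2 = c * n\<^sup>2" if "0 < c" for c n :: real
    using that by (simp add: power2_eq_square)
  then show ?thesis
    using assms unfolding g pos_def_form.dual_pnorm_P[OF J] pnorm_joint_sq[OF assms]
    by (simp add: joint_form_def pos_def_form.dual_pnorm_scale pos_def_form.dual_pnorm_P)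
qed

section \<open>The iterations of DM-SP\<close>

locale dm_sp_arm =
  dm_sp Px Py Lx Lxy Ly Dx Dy \<alpha>x \<alpha>y lam armx army + X: pos_def_form Px + Y: pos_def_form Py
  for Px :: "'a::euclidean_space \<Rightarrow> 'a" and Py :: "'b::euclidean_space \<Rightarrow> 'b"
    and Lx Lxy Ly Dx Dy \<alpha>x \<alpha>y lam :: real
    and armx :: "'a local_solver" and army :: "'b local_solver" +
  assumes pos: "0 < Lx" "0 < Lxy" "0 < Ly" "0 < Dx" "0 < Dy"
    and armx: "ARM_guarantee Px armx" and army: "ARM_guarantee Py army"
    and \<alpha>x: "\<alpha>x = Lxy * Dy / Dx" and \<alpha>y: "\<alpha>y = Lxy * Dx / Dy" and lam: "lam = 2"
begin

lemma \<alpha>_pos: "0 < \<alpha>x" "0 < \<alpha>y"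
  using pos by (simp_all add: \<alpha>x \<alpha>y)

abbreviation P :: "'a \<times> 'b \<Rightarrow> 'a \<times> 'b" where
  "P \<equiv> joint_form \<alpha>x Px \<alpha>y Py"

sublocale J: pos_def_form P
  by (intro pos_def_form_joint X.pos_def_form_axioms Y.pos_def_form_axioms \<alpha>_pos)

lemmas P_pnorm_sq =
  pnorm_joint_sq[OF X.pos_def_form_axioms Y.pos_def_form_axioms \<alpha>_pos]
lemmas P_dual_pnorm_sq =
  dual_pnorm_joint_sq[OF X.pos_def_form_axioms Y.pos_def_form_axioms \<alpha>_pos]

lemma joint_norm_eq: "joint_norm z = pnorm P z"
  by (simp add: joint_norm_def flip: P_pnorm_sq)

lemma joint_dual_norm_eq: "joint_dual_norm g = dual_pnorm P g"
  by (simp add: joint_dual_norm_def flip: P_dual_pnorm_sq)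

section \<open>The problem class and the agents' local solves\<close>

lemma sp_classD:
  assumes "I \<in> sp_class"
  shows "proper_closed_convex (psi_x I)" "proper_closed_convex (psi_y I)" "init I \<in> sp_dom I"
    and "y \<in> edom (psi_y I) \<Longrightarrow> convex_on (edom (psi_x I)) (\<lambda>x. obj I (x, y))"
    and "x \<in> edom (psi_x I) \<Longrightarrow> convex_on (edom (psi_y I)) (\<lambda>y. - obj I (x, y))"
  using assms by (auto simp: sp_class_def concave_on_def)

lemma sp_class_lipschitz:
  assumes "I \<in> sp_class" "x \<in> edom (psi_x I)" "x' \<in> edom (psi_x I)"
    "y \<in> edom (psi_y I)" "y' \<in> edom (psi_y I)"
  shows "dual_pnorm Px (grad_x (obj I) (x', y') - grad_x (obj I) (x, y))
          \<le> Lx * pnorm Px (x' - x) + Lxy * pnorm Py (y' - y)"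
    and "dual_pnorm Py (grad_y (obj I) (x', y') - grad_y (obj I) (x, y))
          \<le> Lxy * pnorm Px (x' - x) + Ly * pnorm Py (y' - y)"
  using assms unfolding sp_class_def by blast+

lemma convex_sp_dom: "I \<in> sp_class \<Longrightarrow> convex (sp_dom I)"
  unfolding sp_dom_def by (intro convex_Times convex_edom sp_classD)

text \<open>An instance of \<open>ARM_prox_step\<close> on the slice at \<open>snd v\<close>, with
  \<open>\<mu> = \<alpha>x * lam\<close>. As that block is frozen, the \<open>Lxy\<close> term of
  the Lipschitz bound vanishes and \<open>Lx\<close> remains.\<close>

lemma local_step_x:
  assumes I: "I \<in> sp_class" and v: "v \<in> sp_dom I"
  shows "real (snd (snd (local_x I v))) \<le> 34 * sqrt (9 * Lx / (2 * (\<alpha>x * lam)))"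
    and "fst (z_next I v) \<in> edom (psi_x I)"
    and "subgrad_x I v \<in> subdiff (psi_x I) (fst (z_next I v))"
    and "dual_pnorm Px (grad_x (obj I) (fst (z_next I v), snd v) + subgrad_x I v
            + (\<alpha>x * lam) *\<^sub>R Px (fst (z_next I v) - fst v))
          \<le> \<alpha>x * lam / 2 * pnorm Px (fst (z_next I v) - fst v)"
proof -
  obtain U where U: "open U" "sp_dom I \<subseteq> U" "C1_on U (obj I)" using I by (auto simp: sp_class_def)
  obtain w g n where res: "local_x I v = (w, g, n)" by (metis prod_cases3)
  let ?U = "{x. (x, snd v) \<in> U}"
  have v': "fst v \<in> edom (psi_x I)" "snd v \<in> edom (psi_y I)" using v by (auto simp: sp_dom_def)
  have U': "open ?U"
    using open_vimage[OF U(1), of "\<lambda>x. (x, snd v)"] by (simp add: vimage_def continuous_on_Pair)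
  have sub: "edom (psi_x I) \<subseteq> ?U" using U(2) v by (auto simp: sp_dom_def)
  have lip: "dual_pnorm Px (grad_x (obj I) (x', snd v) - grad_x (obj I) (x, snd v))
      \<le> Lx * pnorm Px (x' - x)" if "x \<in> edom (psi_x I)" "x' \<in> edom (psi_x I)" for x x'
    using sp_class_lipschitz(1)[OF I that v'(2) v'(2)] by simp
  have G: "grad_x (obj I) (x, snd v) = grad (\<lambda>x. obj I (x, snd v)) x" for x
    by (simp add: grad_x_def)
  have call: "armx (\<lambda>x. grad_x (obj I) (x, snd v))
      (\<lambda>x. psi_x I x + ereal (X.prox_term (\<alpha>x * lam) (fst v) x)) (fst v) (\<alpha>x * lam / 3) Lx = (w, g, n)"
    using res by (simp add: local_x_def psi_hat_x_def[abs_def] X.prox_term_def)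
  have "0 < \<alpha>x * lam" using \<alpha>_pos lam by simp
  note step = X.ARM_prox_step[where f = "\<lambda>x. obj I (x, snd v)" and U = ?U
      and G = "\<lambda>x. grad_x (obj I) (x, snd v)" and \<psi> = "psi_x I" and v = "fst v"
      and \<mu> = "\<alpha>x * lam" and L = Lx and w = w and g = g and n = n, OF armx U' sub
      C1_on_slice_fst[OF U(3)] sp_classD(4)[OF I v'(2)]
      sp_classD(1)[OF I] G lip v'(1) this pos(1) call]
  from step show "real (snd (snd (local_x I v))) \<le> 34 * sqrt (9 * Lx / (2 * (\<alpha>x * lam)))"
    "fst (z_next I v) \<in> edom (psi_x I)"
    "subgrad_x I v \<in> subdiff (psi_x I) (fst (z_next I v))"
    "dual_pnorm Px (grad_x (obj I) (fst (z_next I v), snd v) + subgrad_x I v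
            + (\<alpha>x * lam) *\<^sub>R Px (fst (z_next I v) - fst v))
          \<le> \<alpha>x * lam / 2 * pnorm Px (fst (z_next I v) - fst v)"
    by (simp_all add: z_next_def subgrad_x_def res)
qed

text \<open>The maximizing agent is treated as a minimizer of \<open>- obj\<close>, which is convex
  in its own block.\<close>

lemma local_step_y:
  assumes I: "I \<in> sp_class" and v: "v \<in> sp_dom I"
  shows "real (snd (snd (local_y I v))) \<le> 34 * sqrt (9 * Ly / (2 * (\<alpha>y * lam)))"
    and "snd (z_next I v) \<in> edom (psi_y I)"
    and "subgrad_y I v \<in> subdiff (psi_y I) (snd (z_next I v))"
    and "dual_pnorm Py (- grad_y (obj I) (fst v, snd (z_next I v)) + subgrad_y I v
            + (\<alpha>y * lam) *\<^sub>R Py (snd (z_next I v) - snd v))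
          \<le> \<alpha>y * lam / 2 * pnorm Py (snd (z_next I v) - snd v)"
proof -
  obtain U where U: "open U" "sp_dom I \<subseteq> U" "C1_on U (obj I)" using I by (auto simp: sp_class_def)
  obtain w g n where res: "local_y I v = (w, g, n)" by (metis prod_cases3)
  let ?U = "{y. (fst v, y) \<in> U}"
  note C1 = C1_on_slice_snd[OF U(3), of "fst v"]
  have v': "fst v \<in> edom (psi_x I)" "snd v \<in> edom (psi_y I)" using v by (auto simp: sp_dom_def)
  have U': "open ?U"
    using open_vimage[OF U(1), of "\<lambda>y. (fst v, y)"] by (simp add: vimage_def continuous_on_Pair)
  have sub: "edom (psi_y I) \<subseteq> ?U" using U(2) v by (auto simp: sp_dom_def)
  have lip: "dual_pnorm Py (- grad_y (obj I) (fst v, y') - - grad_y (obj I) (fst v, y))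
      \<le> Ly * pnorm Py (y' - y)" if "y \<in> edom (psi_y I)" "y' \<in> edom (psi_y I)" for y y'
    using sp_class_lipschitz(2)[OF I v'(1) v'(1) that]
    by (subst Y.dual_pnorm_minus[symmetric]) simp
  have G: "- grad_y (obj I) (fst v, y) = grad (\<lambda>y. - obj I (fst v, y)) y" if "y \<in> ?U" for y
    using grad_uminus[OF C1 that] by (simp add: grad_y_def)
  have call: "army (\<lambda>y. - grad_y (obj I) (fst v, y))
      (\<lambda>y. psi_y I y + ereal (Y.prox_term (\<alpha>y * lam) (snd v) y)) (snd v) (\<alpha>y * lam / 3) Ly = (w, g, n)"
    using res by (simp add: local_y_def psi_hat_y_def[abs_def] Y.prox_term_def)
  have "0 < \<alpha>y * lam" using \<alpha>_pos lam by simp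
  note step = Y.ARM_prox_step[where f = "\<lambda>y. - obj I (fst v, y)" and U = ?U
      and G = "\<lambda>y. - grad_y (obj I) (fst v, y)" and \<psi> = "psi_y I" and v = "snd v"
      and \<mu> = "\<alpha>y * lam" and L = Ly and w = w and g = g and n = n, OF army U' sub C1_on_uminus[OF C1] sp_classD(5)[OF I v'(1)]
      sp_classD(2)[OF I] G lip v'(2) this pos(3) call]
  from step show "real (snd (snd (local_y I v))) \<le> 34 * sqrt (9 * Ly / (2 * (\<alpha>y * lam)))"
    "snd (z_next I v) \<in> edom (psi_y I)"
    "subgrad_y I v \<in> subdiff (psi_y I) (snd (z_next I v))"
    "dual_pnorm Py (- grad_y (obj I) (fst v, snd (z_next I v)) + subgrad_y I v
            + (\<alpha>y * lam) *\<^sub>R Py (snd (z_next I v) - snd v))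
          \<le> \<alpha>y * lam / 2 * pnorm Py (snd (z_next I v) - snd v)"
    by (simp_all add: z_next_def subgrad_y_def res)
qed

section \<open>Gap, residual and weight of a single iteration\<close>

lemma z_next_in_dom: "I \<in> sp_class \<Longrightarrow> v \<in> sp_dom I \<Longrightarrow> z_next I v \<in> sp_dom I"
  using local_step_x(2) local_step_y(2) by (simp add: sp_dom_def mem_Times_iff)

text \<open>Gradient inequalities for the two slices through \<open>z\<close> and subgradient
  inequalities for the two regularizers are added; the value of \<open>obj\<close> at
  \<open>z\<close> cancels.\<close>

lemma V_psi_gap:
  assumes I: "I \<in> sp_class" and v: "v \<in> sp_dom I" and u: "u \<in> sp_dom I"
  defines "z \<equiv> z_next I v"
  shows "sp_F I (fst z) (snd u) - sp_F I (fst u) (snd z) \<le> V_psi I v \<bullet> (z - u)"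
proof -
  have z: "fst z \<in> edom (psi_x I)" "snd z \<in> edom (psi_y I)" "z \<in> sp_dom I"
    using z_next_in_dom[OF I v] by (auto simp: z_def sp_dom_def)
  have u': "fst u \<in> edom (psi_x I)" "snd u \<in> edom (psi_y I)" using u by (auto simp: sp_dom_def)
  obtain U where U: "sp_dom I \<subseteq> U" "C1_on U (obj I)" using I by (auto simp: sp_class_def)
  have zU: "(fst z, snd z) \<in> U" using z U by auto
  have gx: "GDERIV (\<lambda>x. obj I (x, snd z)) (fst z) :> grad_x (obj I) z"
    using C1_on_slice_fst[OF U(2), of "snd z"] zU by (simp add: C1_on_def grad_x_def)
  have gy: "GDERIV (\<lambda>y. - obj I (fst z, y)) (snd z) :> - grad_y (obj I) z"
    using C1_on_slice_snd[OF U(2), of "fst z"] zU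
    by (intro GDERIV_minus) (simp add: C1_on_def grad_y_def)
  have "obj I z + grad_x (obj I) z \<bullet> (fst u - fst z) \<le> obj I (fst u, snd z)"
    using convex_on_gradient_inequality[OF sp_classD(4)[OF I z(2)] z(1) u'(1) gx] by simp
  moreover have "- obj I z + - grad_y (obj I) z \<bullet> (snd u - snd z) \<le> - obj I (fst z, snd u)"
    using convex_on_gradient_inequality[OF sp_classD(5)[OF I z(1)] z(2) u'(2) gy] by simp
  moreover have "real_of_ereal (psi_x I (fst z)) + subgrad_x I v \<bullet> (fst u - fst z)
      \<le> real_of_ereal (psi_x I (fst u))"
    using local_step_x(3)[OF I v] u' by (simp add: subdiff_iff[OF sp_classD(1)[OF I]] z_def)
  moreover have "real_of_ereal (psi_y I (snd z)) + subgrad_y I v \<bullet> (snd u - snd z)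
      \<le> real_of_ereal (psi_y I (snd u))"
    using local_step_y(3)[OF I v] u' by (simp add: subdiff_iff[OF sp_classD(2)[OF I]] z_def)
  ultimately show ?thesis
    unfolding V_psi_def z_def[symmetric]
    by (simp add: sp_F_def inner_prod_def inner_add_left inner_diff_left inner_diff_right)
qed

text \<open>The local error is at most \<open>lam / 2\<close> times \<open>pnorm P (z - v)\<close> by the accuracy of the solver.
  The error from freezing the other agent's block is at most \<open>pnorm P (z - v)\<close>, because the weights
  satisfy \<open>\<alpha>x * \<alpha>y = Lxy\<^sup>2\<close>.\<close>

lemma V_psi_residual:
  assumes I: "I \<in> sp_class" and v: "v \<in> sp_dom I"
  defines "z \<equiv> z_next I v"
  shows "dual_pnorm P (V_psi I v + P (2 *\<^sub>R (z - v))) \<le> 2 * pnorm P (z - v)"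
proof -
  define e where "e =
    (grad_x (obj I) (fst z, snd v) + subgrad_x I v + (\<alpha>x * lam) *\<^sub>R Px (fst z - fst v),
     - grad_y (obj I) (fst v, snd z) + subgrad_y I v + (\<alpha>y * lam) *\<^sub>R Py (snd z - snd v))"
  define \<delta> where "\<delta> =
    (grad_x (obj I) z - grad_x (obj I) (fst z, snd v),
     - (grad_y (obj I) z - grad_y (obj I) (fst v, snd z)))"
  let ?dx = "pnorm Px (fst z - fst v)" and ?dy = "pnorm Py (snd z - snd v)"
  have z: "fst z \<in> edom (psi_x I)" "snd z \<in> edom (psi_y I)"
    using z_next_in_dom[OF I v] by (auto simp: z_def sp_dom_def)
  have v': "fst v \<in> edom (psi_x I)" "snd v \<in> edom (psi_y I)" using v by (auto simp: sp_dom_def)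
  have "V_psi I v + P (2 *\<^sub>R (z - v)) = e + \<delta>"
    unfolding V_psi_def z_def[symmetric] e_def \<delta>_def joint_form_def
    by (simp add: X.P_simps Y.P_simps lam mult.commute)
  also have "dual_pnorm P \<dots> \<le> dual_pnorm P e + dual_pnorm P \<delta>" by (rule J.dual_pnorm_triangle)
  finally have tri: "dual_pnorm P (V_psi I v + P (2 *\<^sub>R (z - v))) \<le> dual_pnorm P e + dual_pnorm P \<delta>" .
  have e: "dual_pnorm P e \<le> pnorm P (z - v)"
  proof (rule power2_le_imp_le)
    have "(dual_pnorm Px (fst e))\<^sup>2 \<le> (\<alpha>x * ?dx)\<^sup>2" "(dual_pnorm Py (snd e))\<^sup>2 \<le> (\<alpha>y * ?dy)\<^sup>2"
      using local_step_x(4)[OF I v] local_step_y(4)[OF I v]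
      by (intro power_mono; simp add: e_def z_def lam)+
    then have "(dual_pnorm P e)\<^sup>2 \<le> inverse \<alpha>x * (\<alpha>x * ?dx)\<^sup>2 + inverse \<alpha>y * (\<alpha>y * ?dy)\<^sup>2"
      unfolding P_dual_pnorm_sq using \<alpha>_pos by (intro add_mono mult_left_mono) auto
    also have "\<dots> = (pnorm P (z - v))\<^sup>2"
      unfolding P_pnorm_sq using \<alpha>_pos by (simp add: power2_eq_square field_simps)
    finally show "(dual_pnorm P e)\<^sup>2 \<le> (pnorm P (z - v))\<^sup>2" .
  qed simp
  have "dual_pnorm P \<delta> \<le> pnorm P (z - v)"
  proof (rule power2_le_imp_le)
    have "dual_pnorm Px (grad_x (obj I) (fst z, snd z) - grad_x (obj I) (fst z, snd v))
        \<le> Lx * pnorm Px (fst z - fst z) + Lxy * ?dy"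
      "dual_pnorm Py (grad_y (obj I) (fst z, snd z) - grad_y (obj I) (fst v, snd z))
        \<le> Lxy * ?dx + Ly * pnorm Py (snd z - snd z)"
      using sp_class_lipschitz(1)[OF I z(1,1) v'(2) z(2)] sp_class_lipschitz(2)[OF I v'(1) z(1,2,2)]
      by blast+
    then have "(dual_pnorm Px (fst \<delta>))\<^sup>2 \<le> (Lxy * ?dy)\<^sup>2" "(dual_pnorm Py (snd \<delta>))\<^sup>2 \<le> (Lxy * ?dx)\<^sup>2"
      unfolding \<delta>_def fst_conv snd_conv Y.dual_pnorm_minus by (intro power_mono; simp)+
    then have "(dual_pnorm P \<delta>)\<^sup>2 \<le> inverse \<alpha>x * (Lxy * ?dy)\<^sup>2 + inverse \<alpha>y * (Lxy * ?dx)\<^sup>2"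
      unfolding P_dual_pnorm_sq using \<alpha>_pos by (intro add_mono mult_left_mono) auto
    \<comment> \<open>Here \<open>Lxy\<^sup>2 / \<alpha>x = \<alpha>y\<close> and
      \<open>Lxy\<^sup>2 / \<alpha>y = \<alpha>x\<close>, so the crossed terms carry exactly the
      joint weights.\<close>
    also have "\<dots> = (pnorm P (z - v))\<^sup>2"
      unfolding P_pnorm_sq using pos by (simp add: \<alpha>x \<alpha>y field_simps power2_eq_square)
    finally show "(dual_pnorm P \<delta>)\<^sup>2 \<le> (pnorm P (z - v))\<^sup>2" .
  qed simp
  then show ?thesis using tri e by linarith
qed

text \<open>On squaring the residual bound the terms \<open>4 * (pnorm P d)\<^sup>2\<close> cancel,
  and what remains compares the numerator of the weight with its denominator.\<close>

lemma weight_ge_half: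
  assumes I: "I \<in> sp_class" and v: "v \<in> sp_dom I" and V: "V_psi I v \<noteq> 0"
  shows "1 / 2 \<le> weight I v"
proof -
  define d where "d = z_next I v - v"
  have "0 < dual_pnorm P (V_psi I v)"
    using V J.dual_pnorm_eq_0 J.dual_pnorm_nonneg by (metis less_le)
  have "(dual_pnorm P (V_psi I v + P (2 *\<^sub>R d)))\<^sup>2 \<le> (2 * pnorm P d)\<^sup>2"
    using V_psi_residual[OF I v] by (intro power_mono) (simp_all add: d_def)
  then have "(dual_pnorm P (V_psi I v))\<^sup>2 \<le> 4 * - (V_psi I v \<bullet> d)"
    by (simp add: J.dual_pnorm_sq_add_P J.pnorm_scale power_mult_distrib)
  also have "- (V_psi I v \<bullet> d) = V_psi I v \<bullet> (v - z_next I v)"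
    by (simp add: d_def inner_diff_right)
  finally show ?thesis
    using \<open>0 < dual_pnorm P (V_psi I v)\<close>
    by (simp add: weight_def joint_dual_norm_eq field_simps)
qed

text \<open>The extrapolation weight is chosen so that the linear term
  \<open>weight * (V_psi \<bullet> (v - z))\<close> equals \<open>weight\<^sup>2 * (dual_pnorm P V_psi)\<^sup>2 / 2\<close>.\<close>

lemma weighted_step:
  assumes I: "I \<in> sp_class" and u: "u \<in> sp_dom I" and V: "V_psi I v \<noteq> 0"
    and w: "is_arg_min (prox_objective I v) (\<lambda>u. u \<in> sp_dom I) w"
  shows "weight I v * (V_psi I v \<bullet> (z_next I v - u)) \<le> (pnorm P (u - v))\<^sup>2 / 2 - (pnorm P (u - w))\<^sup>2 / 2"
proof -
  define a V z where "a = weight I v" and "V = V_psi I v" and "z = z_next I v"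
  note convex_sp_dom[OF I]
  moreover have "w \<in> sp_dom I" using w by (simp add: is_arg_min_def)
  moreover have "(a *\<^sub>R V) \<bullet> w + (pnorm P (w - v))\<^sup>2 / 2 \<le> (a *\<^sub>R V) \<bullet> y + (pnorm P (y - v))\<^sup>2 / 2"
    if "y \<in> sp_dom I" for y
  proof -
    have "\<not> prox_objective I v y < prox_objective I v w"
      using w that unfolding is_arg_min_def by blast
    then show ?thesis by (simp add: prox_objective_def joint_norm_eq a_def V_def)
  qed
  ultimately have three: "(a *\<^sub>R V) \<bullet> (w - u)
      \<le> (pnorm P (u - v))\<^sup>2 / 2 - (pnorm P (u - w))\<^sup>2 / 2 - (pnorm P (w - v))\<^sup>2 / 2"
    using u by (intro J.prox_three_point)
  have "dual_pnorm P V \<noteq> 0" using J.dual_pnorm_eq_0[of V] assms(3) unfolding V_def by blast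
  then have a: "a * (V \<bullet> (v - z)) = (a * dual_pnorm P V)\<^sup>2 / 2"
    by (simp add: a_def V_def z_def weight_def joint_dual_norm_eq power2_eq_square)
  \<comment> \<open>The pairing with \<open>z - u\<close> splits through \<open>w\<close> and
    \<open>v\<close>. Of the two half-squares bounding the \<open>v - w\<close> part, one is
    cancelled by the weight identity \<open>a\<close>, the other by the last term of
    \<open>three\<close>.\<close>
  have "(a *\<^sub>R V) \<bullet> (v - w) \<le> dual_pnorm P (a *\<^sub>R V) * pnorm P (v - w)"
    by (rule J.inner_le_dual_pnorm)
  also have "\<dots> \<le> (dual_pnorm P (a *\<^sub>R V))\<^sup>2 / 2 + (pnorm P (w - v))\<^sup>2 / 2"
    using sum_squares_bound[of "dual_pnorm P (a *\<^sub>R V)" "pnorm P (w - v)"]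
    by (simp add: J.pnorm_minus_commute)
  also have "(dual_pnorm P (a *\<^sub>R V))\<^sup>2 = (a * dual_pnorm P V)\<^sup>2"
    by (simp add: J.dual_pnorm_scale power_mult_distrib)
  finally show ?thesis
    using three a unfolding a_def[symmetric] V_def[symmetric] z_def[symmetric]
    by (simp add: inner_diff_right algebra_simps)
qed

text \<open>For fixed \<open>u\<close> the gap is a convex function of each block plus a constant.
  Jensen's inequality then applies to the averaged candidate.\<close>

lemma convex_on_gap:
  assumes I: "I \<in> sp_class" and u: "u \<in> sp_dom I"
  shows "convex_on (sp_dom I) (\<lambda>z. sp_F I (fst z) (snd u) - sp_F I (fst u) (snd z))"
proof -
  let ?px = "\<lambda>x. real_of_ereal (psi_x I x)" and ?py = "\<lambda>y. real_of_ereal (psi_y I y)"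
  have c: "convex_on (edom (psi_x I)) (\<lambda>x. obj I (x, snd u) + ?px x)"
    "convex_on (edom (psi_y I)) (\<lambda>y. - obj I (fst u, y) + ?py y)"
    using u by (intro convex_on_add convex_on_real_of_ereal sp_classD[OF I]; auto simp: sp_dom_def)+
  show ?thesis
    unfolding convex_on_def
  proof (intro conjI ballI allI impI)
    show "convex (sp_dom I)" by (rule convex_sp_dom[OF I])
    fix z w and a b :: real
    assume z: "z \<in> sp_dom I" "w \<in> sp_dom I" and ab: "0 \<le> a" "0 \<le> b" "a + b = 1"
    have "obj I (a *\<^sub>R fst z + b *\<^sub>R fst w, snd u) + ?px (a *\<^sub>R fst z + b *\<^sub>R fst w)
        \<le> a * (obj I (fst z, snd u) + ?px (fst z)) + b * (obj I (fst w, snd u) + ?px (fst w))"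
      using c(1) z ab by (auto simp: convex_on_def sp_dom_def)
    moreover have "- obj I (fst u, a *\<^sub>R snd z + b *\<^sub>R snd w) + ?py (a *\<^sub>R snd z + b *\<^sub>R snd w)
        \<le> a * (- obj I (fst u, snd z) + ?py (snd z)) + b * (- obj I (fst u, snd w) + ?py (snd w))"
      using c(2) z ab by (auto simp: convex_on_def sp_dom_def)
    moreover have "k = a * k + b * k" for k :: real using ab(3) by (simp flip: distrib_right)
    from this[of "?py (snd u)"] this[of "?px (fst u)"]
    have "?py (snd u) + ?px (fst u) = a * (?py (snd u) + ?px (fst u)) + b * (?py (snd u) + ?px (fst u))"
      by (simp add: distrib_left)
    ultimately show "sp_F I (fst (a *\<^sub>R z + b *\<^sub>R w)) (snd u) - sp_F I (fst u) (snd (a *\<^sub>R z + b *\<^sub>R w))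
        \<le> a * (sp_F I (fst z) (snd u) - sp_F I (fst u) (snd z))
          + b * (sp_F I (fst w) (snd u) - sp_F I (fst u) (snd w))"
      by (simp add: sp_F_def algebra_simps)
  qed
qed

section \<open>Runs and the number of iterations\<close>

lemma run_in_dom:
  assumes I: "I \<in> sp_class" and run: "is_run \<epsilon> I v"
    and unsolved: "\<And>k. k \<in> {1..t} \<Longrightarrow> \<not> eps_saddle \<epsilon> I (candidate I v k)"
  shows "v t \<in> sp_dom I"
proof (cases t)
  case 0
  then show ?thesis using I run by (simp add: is_run_def sp_class_def)
next
  \<comment> \<open>\<open>is_run\<close> constrains \<open>v (Suc s)\<close> only while all
    candidates up to \<open>Suc s\<close> fail, which is the range covered by
    \<open>unsolved\<close>.\<close>
  case (Suc s)
  then have "is_arg_min (prox_objective I (v s)) (\<lambda>u. u \<in> sp_dom I) (v (Suc s))"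
    using run unsolved unfolding is_run_def by blast
  then show ?thesis by (simp add: is_arg_min_def Suc)
qed

text \<open>With a zero operator value \<open>V_psi_gap\<close> bounds the gap by 0 against the
  whole domain, and the candidate is then \<open>z_next\<close> itself.\<close>

lemma solved_if_V_psi_0:
  assumes I: "I \<in> sp_class" and v: "v t \<in> sp_dom I" and V: "V_psi I (v t) = 0" and \<epsilon>: "0 < \<epsilon>"
  shows "eps_saddle \<epsilon> I (candidate I v (Suc t))"
proof -
  let ?z = "z_next I (v t)"
  have "sp_F I (fst ?z) (snd u) - sp_F I (fst u) (snd ?z) \<le> \<epsilon>" if "u \<in> sp_dom I" for u
    using V_psi_gap[OF I v that] V \<epsilon> by simp
  then have "sp_F I (fst ?z) y - sp_F I x (snd ?z) \<le> \<epsilon>" if "(x, y) \<in> sp_dom I" for x y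
    using that by fastforce
  then show ?thesis
    using z_next_in_dom[OF I v] V
    by (auto simp: eps_saddle_def candidate_def sp_gap_def intro!: SUP_least)
qed

text \<open>Assuming that every candidate fails keeps the run constrained and \<open>V_psi\<close>
  nonzero for all \<open>n\<close> iterations, so the weighted steps telescope and candidate
  \<open>n\<close> succeeds after all.\<close>

lemma eps_saddle_within:
  assumes I: "I \<in> sp_class" and run: "is_run \<epsilon> I v" and \<epsilon>: "0 < \<epsilon>"
    and n: "1 \<le> n" "2 * Lxy * Dx * Dy / \<epsilon> \<le> real n"
  shows "\<exists>k\<in>{1..n}. eps_saddle \<epsilon> I (candidate I v k)"
proof (rule ccontr)
  assume "\<not> ?thesis"
  then have no: "\<not> eps_saddle \<epsilon> I (candidate I v k)" if "k \<in> {1..n}" for k using that by blast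
  have dom: "v t \<in> sp_dom I" if "t < n" for t
    using that no by (intro run_in_dom[OF I run]) auto
  have V: "V_psi I (v t) \<noteq> 0" if "t < n" for t
    using solved_if_V_psi_0[of I v t, OF I dom[OF that] _ \<epsilon>] no[of "Suc t"] that by auto
  define a where "a t = weight I (v t)" for t
  define z where "z t = z_next I (v t)" for t
  define A where "A = (\<Sum>t<n. a t)"
  have a: "1 / 2 \<le> a t" if "t < n" for t
    using weight_ge_half[OF I dom V] that by (simp add: a_def)
  have "real n * (1 / 2) \<le> A"
    unfolding A_def using sum_bounded_below[of "{..<n}" "1 / 2" a] a by simp
  then have A: "real n / 2 \<le> A" "0 < A" using n by auto
  have zdom: "z t \<in> sp_dom I" if "t < n" for t
    using z_next_in_dom[OF I dom[OF that]] by (simp add: z_def)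
  define zb where "zb = (\<Sum>t<n. (a t / A) *\<^sub>R z t)"
  have cand: "candidate I v n = zb"
    using n V[of "n - 1"]
    by (simp add: candidate_def zb_def a_def z_def A_def scaleR_sum_right divide_inverse mult.commute)
  have wsum: "(\<Sum>t<n. a t / A) = 1" "\<And>t. t < n \<Longrightarrow> 0 \<le> a t / A"
    using A a by (simp_all add: A_def flip: sum_divide_distrib) (fastforce simp: A_def)
  have zb: "zb \<in> sp_dom I"
    unfolding zb_def by (rule convex_sum[OF _ convex_sp_dom[OF I]]) (use wsum zdom in auto)
  have "sp_F I (fst zb) (snd u) - sp_F I (fst u) (snd zb) \<le> \<epsilon>"
    if u: "u \<in> sp_dom I" and ball: "u \<in> sp_ball I" for u
  proof -
    let ?\<Phi> = "\<lambda>z. sp_F I (fst z) (snd u) - sp_F I (fst u) (snd z)"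
    have arg: "is_arg_min (prox_objective I (v t)) (\<lambda>u. u \<in> sp_dom I) (v (Suc t))" if "t < n" for t
      using run no that unfolding is_run_def by auto
    have "?\<Phi> zb \<le> (\<Sum>t<n. a t / A * ?\<Phi> (z t))"
      unfolding zb_def
      by (rule convex_on_sum[OF _ _ convex_on_gap[OF I u]]) (use wsum zdom n in \<open>auto simp: lessThan_empty_iff\<close>)
    also have "\<dots> \<le> (\<Sum>t<n. 1 / A * (a t * (V_psi I (v t) \<bullet> (z t - u))))"
    proof (rule sum_mono)
      fix t assume "t \<in> {..<n}"
      then have "a t / A * ?\<Phi> (z t) \<le> a t / A * (V_psi I (v t) \<bullet> (z t - u))"
        using V_psi_gap[OF I dom u] wsum(2) by (intro mult_left_mono) (auto simp: z_def)
      then show "a t / A * ?\<Phi> (z t) \<le> 1 / A * (a t * (V_psi I (v t) \<bullet> (z t - u)))" by simp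
    qed
    also have "\<dots> = 1 / A * (\<Sum>t<n. a t * (V_psi I (v t) \<bullet> (z t - u)))"
      by (simp only: sum_distrib_left)
    also have "\<dots> \<le> 1 / A * (\<Sum>t<n. (pnorm P (u - v t))\<^sup>2 / 2 - (pnorm P (u - v (Suc t)))\<^sup>2 / 2)"
      unfolding a_def z_def using A(2)
      by (intro mult_left_mono sum_mono weighted_step[OF I u V arg]) auto
    also have "\<dots> = 1 / A * ((pnorm P (u - v 0))\<^sup>2 / 2 - (pnorm P (u - v n))\<^sup>2 / 2)"
      by (subst sum_lessThan_telescope') simp
    also have "\<dots> \<le> 1 / A * (Lxy * Dx * Dy)"
    proof (intro mult_left_mono)
      have "(pnorm Px (fst u - fst (init I)))\<^sup>2 \<le> Dx\<^sup>2" "(pnorm Py (snd u - snd (init I)))\<^sup>2 \<le> Dy\<^sup>2"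
        using ball by (auto simp: sp_ball_def X.pnorm_minus_commute Y.pnorm_minus_commute intro!: power_mono)
      then have "(pnorm P (u - v 0))\<^sup>2 \<le> \<alpha>x * Dx\<^sup>2 + \<alpha>y * Dy\<^sup>2"
        unfolding P_pnorm_sq using \<alpha>_pos run
        by (intro add_mono mult_left_mono) (auto simp: is_run_def)
      \<comment> \<open>The choice of the weights balances the blocks:
        \<open>\<alpha>x * Dx\<^sup>2\<close> and \<open>\<alpha>y * Dy\<^sup>2\<close> both equal
        \<open>Lxy * Dx * Dy\<close>.\<close>
      also have "\<dots> = 2 * (Lxy * Dx * Dy)"
        using pos by (simp add: \<alpha>x \<alpha>y power2_eq_square)
      finally show "(pnorm P (u - v 0))\<^sup>2 / 2 - (pnorm P (u - v n))\<^sup>2 / 2 \<le> Lxy * Dx * Dy"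
        using zero_le_power2[of "pnorm P (u - v n)"] by linarith
    qed (use A in simp)
    also have "\<dots> \<le> \<epsilon>"
    proof -
      \<comment> \<open>The choice of \<open>n\<close> meets the weight bound: half of
        \<open>n\<close> is at most \<open>A\<close>.\<close>
      have "2 * Lxy * Dx * Dy \<le> real n * \<epsilon>" using n(2) \<epsilon> by (simp add: field_simps)
      also have "\<dots> \<le> 2 * A * \<epsilon>" using A \<epsilon> by (intro mult_right_mono) auto
      finally show ?thesis using A by (simp add: field_simps)
    qed
    finally show ?thesis .
  qed
  then have "eps_saddle \<epsilon> I zb"
    using zb by (auto simp: eps_saddle_def sp_gap_def intro!: SUP_least)
  then show False using no[of n] n cand by simp
qed

section \<open>Counting queries\<close>

lemma run_cost_bound:
  assumes I: "I \<in> sp_class" and run: "is_run \<epsilon> I v" and \<epsilon>: "0 < \<epsilon>" and c: "0 \<le> cx" "0 \<le> cy"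
    and n: "1 \<le> n" "2 * Lxy * Dx * Dy / \<epsilon> \<le> real n"
  shows "run_cost cx cy \<epsilon> I v \<le>
     ereal (real n * (cx * (34 * sqrt (9 * Lx / (2 * (\<alpha>x * lam))) + 1)
                    + cy * (34 * sqrt (9 * Ly / (2 * (\<alpha>y * lam))) + 1)))"
proof -
  obtain k where k: "k \<in> {1..n}" "eps_saddle \<epsilon> I (candidate I v k)"
    using eps_saddle_within[OF I run \<epsilon> n] by blast
  then have k_solved: "solved_after \<epsilon> I v (2 * k)" by (simp add: solved_after_def)
  define T where "T = (LEAST T. solved_after \<epsilon> I v T)"
  have T: "solved_after \<epsilon> I v T" and T_min: "\<And>s. s < T \<Longrightarrow> \<not> solved_after \<epsilon> I v s"
    unfolding T_def using k_solved by (auto intro: LeastI dest: not_less_Least)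
  define m where "m = T div 2"
  \<comment> \<open>Beyond \<open>2 \<le> T\<close>, \<open>solved_after\<close> depends on
    \<open>T\<close> only through \<open>T div 2\<close>. An odd solving \<open>T\<close> would make
    \<open>T - 1\<close> solve as well, so the least one ends a complete iteration.\<close>
  have "T = 2 * m"
  proof (rule ccontr)
    assume "T \<noteq> 2 * m"
    then have "2 * m < T" "2 \<le> 2 * m" using T by (auto simp: m_def solved_after_def)
    moreover have "solved_after \<epsilon> I v (2 * m)" using T \<open>2 \<le> 2 * m\<close> by (simp add: solved_after_def m_def)
    ultimately show False using T_min by blast
  qed
  moreover have "T \<le> 2 * k" unfolding T_def using k_solved by (rule Least_le)
  ultimately have m: "T = 2 * m" "m \<le> n" using k by auto
  have "\<not> eps_saddle \<epsilon> I (candidate I v j)" if "1 \<le> j" "j < m" for j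
    using T_min[of "2 * j"] that m by (auto simp: solved_after_def)
  then have dom: "v t \<in> sp_dom I" if "t < m" for t
    using that by (intro run_in_dom[OF I run]) auto
  let ?Nx = "34 * sqrt (9 * Lx / (2 * (\<alpha>x * lam)))" and ?Ny = "34 * sqrt (9 * Ly / (2 * (\<alpha>y * lam)))"
  have "(\<Sum>t<m. real (snd (snd (local_x I (v t))))) \<le> real m * ?Nx"
    using sum_bounded_above[of "{..<m}" "\<lambda>t. real (snd (snd (local_x I (v t))))" ?Nx]
      local_step_x(1)[OF I dom] by simp
  \<comment> \<open>For \<open>T = 2 * m\<close> both \<open>(T + 1) div 2\<close> and
    \<open>T div 2\<close> equal \<open>m\<close>: the local solves, and one further query per
    iteration.\<close>
  then have qx: "real (queries_x I v T) \<le> real m * (?Nx + 1)"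
    by (simp add: queries_x_def m distrib_left)
  have "(\<Sum>t<m. real (snd (snd (local_y I (v t))))) \<le> real m * ?Ny"
    using sum_bounded_above[of "{..<m}" "\<lambda>t. real (snd (snd (local_y I (v t))))" ?Ny]
      local_step_y(1)[OF I dom] by simp
  then have qy: "real (queries_y I v T) \<le> real m * (?Ny + 1)"
    by (simp add: queries_y_def m distrib_left)
  have "cx * real (queries_x I v T) + cy * real (queries_y I v T)
      \<le> cx * (real m * (?Nx + 1)) + cy * (real m * (?Ny + 1))"
    using c qx qy by (intro add_mono mult_left_mono)
  also have "\<dots> = real m * (cx * (?Nx + 1) + cy * (?Ny + 1))" by (simp add: algebra_simps)
  also have "\<dots> \<le> real n * (cx * (?Nx + 1) + cy * (?Ny + 1))"
    using m c pos \<alpha>_pos lam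
    by (intro mult_right_mono add_nonneg_nonneg mult_nonneg_nonneg real_sqrt_ge_zero divide_nonneg_nonneg) auto
  finally show ?thesis
    using k_solved by (auto simp: run_cost_def T_def[symmetric] Let_def)
qed

end

text \<open>\<open>B\<close> is \<open>K\<close> times the cost bound of one iteration, while the
  number of iterations is an integer, at most \<open>\<lceil>K\<rceil>\<close>. Rounding up is the
  factor \<open>\<lceil>K\<rceil> / K\<close>, which equals 1 when \<open>K\<close> is an
  integer.\<close>

theorem theorem5p2:
  fixes Px :: "'a::euclidean_space \<Rightarrow> 'a" and Py :: "'b::euclidean_space \<Rightarrow> 'b"
    and Lx Lxy Ly Dx Dy \<epsilon> cx cy \<alpha>x \<alpha>y lam :: real
    and armx :: "'a local_solver" and army :: "'b local_solver"
  assumes "self_adjoint_pos_def Px" and "self_adjoint_pos_def Py"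
    and "0 < Lx" and "0 < Lxy" and "0 < Ly" and "0 < Dx" and "0 < Dy" and "0 < \<epsilon>"
    and "0 \<le> cx" and "0 \<le> cy"
    and "ARM_guarantee Px armx" and "ARM_guarantee Py army"
    and "\<alpha>x = Lxy * Dy / Dx" and "\<alpha>y = Lxy * Dx / Dy" and "lam = 2"
  shows "let N = dm_sp.oracle_complexity Px Py Lx Lxy Ly Dx Dy \<alpha>x \<alpha>y lam armx army cx cy \<epsilon>;
             K = 2 * Lxy * Dx * Dy / \<epsilon>;
             B = (cx + cy) * (2 * Lxy * Dx * Dy / \<epsilon>)
                 + 102 * sqrt (Lxy * Dx * Dy / \<epsilon>)
                   * (cx * sqrt (Lx * Dx\<^sup>2 / \<epsilon>) + cy * sqrt (Ly * Dy\<^sup>2 / \<epsilon>))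
         in N \<le> ereal (of_int \<lceil>K\<rceil> / K * B) \<and> (K \<in> \<int> \<longrightarrow> N \<le> ereal B)"
proof -
  interpret dm_sp_arm Px Py Lx Lxy Ly Dx Dy \<alpha>x \<alpha>y lam armx army
    using assms by unfold_locales auto
  define K where "K = 2 * Lxy * Dx * Dy / \<epsilon>"
  define B where "B = (cx + cy) * K + 102 * sqrt (Lxy * Dx * Dy / \<epsilon>)
                   * (cx * sqrt (Lx * Dx\<^sup>2 / \<epsilon>) + cy * sqrt (Ly * Dy\<^sup>2 / \<epsilon>))"
  have "0 < K" using assms by (simp add: K_def)
  define n where "n = nat \<lceil>K\<rceil>"
  have n: "real n = of_int \<lceil>K\<rceil>" "1 \<le> n" "K \<le> real n"
    using \<open>0 < K\<close> by (auto simp: n_def nat_le_iff le_nat_iff)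
  let ?b = "cx * (34 * sqrt (9 * Lx / (2 * (\<alpha>x * lam))) + 1)
          + cy * (34 * sqrt (9 * Ly / (2 * (\<alpha>y * lam))) + 1)"
  \<comment> \<open>A generic pair \<open>D\<close>, \<open>E\<close> serves both agents by swapping
    \<open>Dx\<close> and \<open>Dy\<close>. The constant 102 is \<open>34 * 3\<close>, with 3 from
    \<open>sqrt 9\<close>; \<open>K\<close> is compared by moving its square under the root.\<close>
  have rt: "34 * sqrt (9 * L / (2 * (Lxy * E / D * 2))) * K
      = 102 * sqrt (Lxy * D * E / \<epsilon>) * sqrt (L * D\<^sup>2 / \<epsilon>)" if "0 < D" "0 < E" "D * E = Dx * Dy" for L D E
  proof -
    have "9 * L / (2 * (Lxy * E / D * 2)) * K\<^sup>2 = 3\<^sup>2 * (Lxy * D * E / \<epsilon> * (L * D\<^sup>2 / \<epsilon>))"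
    proof -
      have K: "K = 2 * Lxy * D * E / \<epsilon>" using that by (simp add: K_def mult.assoc)
      show ?thesis unfolding K using that assms by (simp add: field_simps power2_eq_square)
    qed
    then have "sqrt (9 * L / (2 * (Lxy * E / D * 2)) * K\<^sup>2)
        = sqrt (3\<^sup>2 * (Lxy * D * E / \<epsilon> * (L * D\<^sup>2 / \<epsilon>)))" by (rule arg_cong)
    then show ?thesis using \<open>0 < K\<close> unfolding real_sqrt_mult by (simp add: mult.commute[of K])
  qed
  have "?b * K = cx * (34 * sqrt (9 * Lx / (2 * (\<alpha>x * lam))) * K)
      + cy * (34 * sqrt (9 * Ly / (2 * (\<alpha>y * lam))) * K) + (cx + cy) * K"
    by (simp add: algebra_simps)
  also have "\<dots> = B"
    unfolding B_def \<alpha>x \<alpha>y lam using rt[of Dx Dy Lx] rt[of Dy Dx Ly] pos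
    by (simp only: mult.commute[of Dy Dx]) (simp add: algebra_simps)
  finally have "?b * K = B" .
  then have b: "real n * ?b = of_int \<lceil>K\<rceil> / K * B"
    using \<open>0 < K\<close> by (simp add: n(1) flip: \<open>?b * K = B\<close>)
  have N: "oracle_complexity cx cy \<epsilon> \<le> ereal (of_int \<lceil>K\<rceil> / K * B)"
    unfolding oracle_complexity_def
  proof (rule SUP_least, clarify)
    fix I v assume "I \<in> sp_class" "is_run \<epsilon> I v"
    from run_cost_bound[OF this \<open>0 < \<epsilon>\<close> \<open>0 \<le> cx\<close> \<open>0 \<le> cy\<close> n(2) n(3)[unfolded K_def]]
    show "run_cost cx cy \<epsilon> I v \<le> ereal (of_int \<lceil>K\<rceil> / K * B)" unfolding b .
  qed
  moreover have "of_int \<lceil>K\<rceil> / K * B = B" if "K \<in> \<int>"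
    using that \<open>0 < K\<close> by (auto elim: Ints_cases)
  ultimately have "oracle_complexity cx cy \<epsilon> \<le> ereal (of_int \<lceil>K\<rceil> / K * B)
      \<and> (K \<in> \<int> \<longrightarrow> oracle_complexity cx cy \<epsilon> \<le> ereal B)"
    by metis
  then show ?thesis unfolding Let_def B_def K_def .
qed

end
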